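(* Let $\mathcal{G} = (\mathcal{V}, \mathcal{E}, |\cdot|)$ be an (infinite) tessellating metric graph. Suppose $$c_\ast(\mathcal{G}) := \inf_{e \in \mathcal{E}} c(e) > 0.$$ Then $$\alpha(\mathcal{G}) \geq \frac{c_\ast (\mathcal{G})}{K (\mathcal{G})} > 0,$$ where $$K(\mathcal{G}) := 1- \frac{1}{M(\mathcal{G})} - \frac{2}{P(\mathcal{G})} - \frac{1}{(M(\mathcal{G}) -2) P(\mathcal{G})},\qquad M(\mathcal{G}) := \sup_{v\in\mathcal{V}} \frac{m(v)}{\inf_{e\in\mathcal{E}_v}|e|},\qquad P(\mathcal{G}) := \sup_{T \in \mathcal{T}} \frac{p(T)}{\inf_{e\in \mathcal{E}_T}|e|}.$$
   Context: **Tessellating graphs.** $\mathcal{G}_d = (\mathcal{V}, \mathcal{E})$ is an unoriented graph with countably infinite vertex set $\mathcal{V}$ and edge set $\mathcal{E}$; it is connected, simple (no loops or multiple edges) and locally finite. For $v\in\mathcal{V}$, $\mathcal{E}_v$ is the set of edges incident to $v$ and $\deg(v)=\#\mathcal{E}_v<\infty$. The graph is planar with a fixed planar embedding, so that $\mathcal{G}_d$ is regarded as a subset of $\mathbb{R}^2$, assumed closed. $\mathcal{T}$ is the set of faces (called tiles), i.e. the closures of the connected components of $\mathbb{R}^2\setminus\mathcal{G}_d$ (unbounded ones included). $\mathcal{G}_d$ is *tessellating* if: (i) $\mathcal{T}$ is locally finite: each compact subset of $\mathbb{R}^2$ intersects only finitely many tiles; (ii) each bounded tile $T$ is a closed topological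 disc and $\partial T$ consists of a finite cycle of at least three edges; (iii) each unbounded tile $T$ is a closed topological half-plane and $\partial T$ consists of a (countably) infinite chain of edges; (iv) each edge is contained in the boundary of precisely two different tiles; (v) each vertex has degree $\ge 3$. Here a closed topological disc (half-plane) is the image of the closed unit ball of $\mathbb{R}^2$ (closed upper half-plane) under a homeomorphism $\mathbb{R}^2\to\mathbb{R}^2$. For $T\in\mathcal{T}$ let $\mathcal{E}_T=\{e\in\mathcal{E} : e\subseteq\partial T\}$. **Metric graph.** A tessellating metric graph $\mathcal{G}=(\mathcal{V},\mathcal{E},|\cdot|)$ is a tessellating graph $\mathcal{G}_d$ together with a length $|e|\in(0,\infty)$ for each edge $e$. For a subgraph $\widetilde{\mathcal{G}}=(\widetilde{\mathcal{V}},\widetilde{\mathcal{E}})$, $\mathrm{mes}(\widetilde{\mathcal{G}})=\sum_{e\in\widetilde{\mathcal{E}}}|e|$, and its boundary vertices are $\partial_{\mathcal{G}}\widetilde{\mathcal{G}}=\{v\in\widetilde{\mathcal{V}} : \deg_{\widetilde{\mathcal{G}}}(v)<\deg(v)\}$, where $\deg_{\widetilde{\mathcal{G}}}$ is the degree in $\widetilde{\mathcal{G}}$. For finite $\widetilde{\mathcal{G}}$, $\deg(\partial_{\mathcal{G}}\widetilde{\mathcal{G}})=\sum_{v\in\partial_{\mathcal{G}}\widetilde{\mathcal{G}}}\deg_{\widetilde{\mathcal{G}}}(v)$. **Isoperimetric constant.** $$\alpha(\mathcal{G})=\inf_{\widetilde{\mathcal{G}}}\frac{\deg(\partial_{\mathcal{G}}\widetilde{\mathcal{G}})}{\mathrm{mes}(\widetilde{\mathcal{G}})}\in[0,\infty),$$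 the infimum over all finite connected subgraphs $\widetilde{\mathcal{G}}\subset\mathcal{G}$ (with at least one edge). **Characteristic values.** For $v\in\mathcal{V}$, $m(v)=\sum_{e\in\mathcal{E}_v}|e|$. For $T\in\mathcal{T}$, $p(T)=\sum_{e\in\mathcal{E}_T}|e|$ if $T$ is bounded and $p(T)=\infty$ if $T$ is unbounded. For $e\in\mathcal{E}$, $$c(e)=\frac1{|e|}-\sum_{v: v\in e}\frac1{m(v)}-\sum_{T: e\subseteq\partial T}\frac1{p(T)},$$ the sums being over the two endpoints of $e$ and the two tiles containing $e$ in their boundary. **Convention.** $M(\mathcal{G})$ and $P(\mathcal{G})$ take values in $(0,\infty]$ (in particular $P(\mathcal{G})=\infty$ if there is an unbounded tile), and a fraction whose denominator is $\infty$ is interpreted as $0$. *)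

theory Defs
  imports "HOL-Analysis.Analysis"
begin

text \<open>
  The plane is the type \<^typ>\<open>complex\<close>, as in the library's Jordan curve theorem.  A graph
  embedded in the plane is given by its set V of vertices (points) and its set E of edges
  (closed arcs, containing their two endpoints), so \<open>e \<inter> V\<close> is the pair of endpoints of e.
\<close>

definition joins :: "complex set \<Rightarrow> complex set \<Rightarrow> complex \<Rightarrow> complex \<Rightarrow> bool" where
  "joins V e x y \<longleftrightarrow> e \<inter> V = {x, y}"

definition incident_edges :: "complex set set \<Rightarrow> complex \<Rightarrow> complex set set" where
  "incident_edges E v = {e \<in> E. v \<in> e}"

definition degree_in :: "complex set set \<Rightarrow> complex \<Rightarrow> nat" where
  "degree_in E v = card (incident_edges E v)"

definition connected_graph :: "complex set \<Rightarrow> complex set set \<Rightarrow> bool" where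
  "connected_graph V E \<longleftrightarrow> V \<noteq> {} \<and>
     (\<forall>u\<in>V. \<forall>v\<in>V. (u, v) \<in> {(x, y). \<exists>e\<in>E. joins V e x y}\<^sup>*)"

definition support :: "complex set \<Rightarrow> complex set set \<Rightarrow> complex set" where
  "support V E = V \<union> \<Union>E"

definition tiles :: "complex set \<Rightarrow> complex set set \<Rightarrow> complex set set" where
  "tiles V E = closure ` components (- support V E)"

definition tile_edges :: "complex set set \<Rightarrow> complex set \<Rightarrow> complex set set" where
  "tile_edges E T = {e \<in> E. e \<subseteq> frontier T}"

definition edge_tiles :: "complex set \<Rightarrow> complex set set \<Rightarrow> complex set \<Rightarrow> complex set set" where
  "edge_tiles V E e = {T \<in> tiles V E. e \<subseteq> frontier T}"

definition closed_topological_disc :: "complex set \<Rightarrow> bool" where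
  "closed_topological_disc T \<longleftrightarrow>
     (\<exists>f g. homeomorphism (UNIV :: complex set) (UNIV :: complex set) f g \<and> T = f ` cball 0 1)"

definition closed_topological_half_plane :: "complex set \<Rightarrow> bool" where
  "closed_topological_half_plane T \<longleftrightarrow>
     (\<exists>f g. homeomorphism (UNIV :: complex set) (UNIV :: complex set) f g \<and> T = f ` {z. 0 \<le> Im z})"

definition is_finite_cycle :: "complex set \<Rightarrow> complex set set \<Rightarrow> complex set \<Rightarrow> bool" where
  "is_finite_cycle V E B \<longleftrightarrow>
     (\<exists>n\<ge>3. \<exists>(v :: nat \<Rightarrow> complex) e. inj_on v {..<n} \<and>
        (\<forall>i<n. e i \<in> E \<and> joins V (e i) (v i) (v (Suc i mod n))) \<and>
        B = (\<Union>i<n. e i))"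

text \<open>
  The chain is infinite in both directions, since it has to make up the boundary of a topological
  half-plane, which is homeomorphic to the real line.
\<close>

definition is_infinite_chain :: "complex set \<Rightarrow> complex set set \<Rightarrow> complex set \<Rightarrow> bool" where
  "is_infinite_chain V E B \<longleftrightarrow>
     (\<exists>(v :: int \<Rightarrow> complex) e. inj v \<and>
        (\<forall>i. e i \<in> E \<and> joins V (e i) (v i) (v (i + 1))) \<and>
        B = (\<Union>i. e i))"

text \<open>
  Loops are excluded by \<^const>\<open>arc\<close>, whose endpoints are distinct, and multiple edges by
  \<open>simple\<close>.
\<close>

locale planar_graph =
  fixes V :: "complex set" and E :: "complex set set"
  assumes infinite_vertices: "infinite V"
    and countable_vertices: "countable V"
    and edge_arc: "e \<in> E \<Longrightarrow>
      \<exists>g. arc g \<and> path_image g = e \<and> e \<inter> V = {pathstart g, pathfinish g}"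
    and edges_meet: "e \<in> E \<Longrightarrow> e' \<in> E \<Longrightarrow> e \<noteq> e' \<Longrightarrow> e \<inter> e' \<subseteq> V"
    and simple: "e \<in> E \<Longrightarrow> e' \<in> E \<Longrightarrow> e \<inter> V = e' \<inter> V \<Longrightarrow> e = e'"
    and locally_finite: "v \<in> V \<Longrightarrow> finite (incident_edges E v)"
    and connected: "connected_graph V E"
    and closed_support: "closed (support V E)"

locale tessellating_graph = planar_graph +
  assumes tiles_locally_finite: "compact C \<Longrightarrow> finite {T \<in> tiles V E. T \<inter> C \<noteq> {}}"
    and bounded_tile: "T \<in> tiles V E \<Longrightarrow> bounded T \<Longrightarrow>
      closed_topological_disc T \<and> is_finite_cycle V E (frontier T)"
    and unbounded_tile: "T \<in> tiles V E \<Longrightarrow> \<not> bounded T \<Longrightarrow>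
      closed_topological_half_plane T \<and> is_infinite_chain V E (frontier T)"
    and edge_two_tiles: "e \<in> E \<Longrightarrow> card (edge_tiles V E e) = 2"
    and degree_ge_3: "v \<in> V \<Longrightarrow> degree_in E v \<ge> 3"

locale tessellating_metric_graph = tessellating_graph +
  fixes len :: "complex set \<Rightarrow> real"
  assumes len_pos: "e \<in> E \<Longrightarrow> 0 < len e"

definition subgraph :: "complex set \<Rightarrow> complex set set \<Rightarrow> complex set \<Rightarrow> complex set set \<Rightarrow> bool" where
  "subgraph V' E' V E \<longleftrightarrow> V' \<subseteq> V \<and> E' \<subseteq> E \<and> (\<forall>e\<in>E'. e \<inter> V \<subseteq> V')"

definition mes :: "(complex set \<Rightarrow> real) \<Rightarrow> complex set set \<Rightarrow> real" where
  "mes len E' = (\<Sum>e\<in>E'. len e)"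

definition boundary_vertices :: "complex set set \<Rightarrow> complex set \<Rightarrow> complex set set \<Rightarrow> complex set" where
  "boundary_vertices E V' E' = {v \<in> V'. degree_in E' v < degree_in E v}"

definition boundary_degree :: "complex set set \<Rightarrow> complex set \<Rightarrow> complex set set \<Rightarrow> nat" where
  "boundary_degree E V' E' = (\<Sum>v\<in>boundary_vertices E V' E'. degree_in E' v)"

definition isoperimetric_constant ::
  "complex set \<Rightarrow> complex set set \<Rightarrow> (complex set \<Rightarrow> real) \<Rightarrow> ereal" where
  "isoperimetric_constant V E len =
     (INF (V', E') \<in> {(V', E'). subgraph V' E' V E \<and> finite V' \<and> finite E' \<and> E' \<noteq> {} \<and>
                               connected_graph V' E'}.
        ereal (real (boundary_degree E V' E') / mes len E'))"

definition vertex_weight :: "complex set set \<Rightarrow> (complex set \<Rightarrow> real) \<Rightarrow> complex \<Rightarrow> real" where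
  "vertex_weight E len v = (\<Sum>e\<in>incident_edges E v. len e)"

definition perimeter :: "complex set set \<Rightarrow> (complex set \<Rightarrow> real) \<Rightarrow> complex set \<Rightarrow> ereal" where
  "perimeter E len T = (if bounded T then ereal (\<Sum>e\<in>tile_edges E T. len e) else \<infinity>)"

text \<open>
  Below, \<^typ>\<open>ereal\<close> division gives \<open>1 / \<infinity> = 0\<close> and \<open>\<infinity> / r = \<infinity>\<close> for \<open>0 \<le> r < \<infinity>\<close>, so an unbounded
  tile contributes \<open>0\<close> to the characteristic value and makes \<open>P_const\<close> infinite.
\<close>

definition char_value ::
  "complex set \<Rightarrow> complex set set \<Rightarrow> (complex set \<Rightarrow> real) \<Rightarrow> complex set \<Rightarrow> ereal" where
  "char_value V E len e =
     ereal (1 / len e) - (\<Sum>v\<in>e \<inter> V. ereal (1 / vertex_weight E len v))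
       - (\<Sum>T\<in>edge_tiles V E e. 1 / perimeter E len T)"

definition c_star :: "complex set \<Rightarrow> complex set set \<Rightarrow> (complex set \<Rightarrow> real) \<Rightarrow> ereal" where
  "c_star V E len = (INF e\<in>E. char_value V E len e)"

definition M_const :: "complex set \<Rightarrow> complex set set \<Rightarrow> (complex set \<Rightarrow> real) \<Rightarrow> ereal" where
  "M_const V E len =
     (SUP v\<in>V. ereal (vertex_weight E len v) / (INF e\<in>incident_edges E v. ereal (len e)))"

definition P_const :: "complex set \<Rightarrow> complex set set \<Rightarrow> (complex set \<Rightarrow> real) \<Rightarrow> ereal" where
  "P_const V E len =
     (SUP T\<in>tiles V E. perimeter E len T / (INF e\<in>tile_edges E T. ereal (len e)))"

definition K_const :: "complex set \<Rightarrow> complex set set \<Rightarrow> (complex set \<Rightarrow> real) \<Rightarrow> ereal" where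
  "K_const V E len =
     (let M = M_const V E len; P = P_const V E len
      in 1 - 1 / M - 2 / P - 1 / ((M - 2) * P))"

end

(* For a finite vertex set U let b be the number of edges leaving U.  Summing |e| c(e) over the edges
   meeting U, every vertex of U and every tile bounded by inner edges of U ("full" tile) contributes
   exactly 1, and Euler's formula turns the total into
     c* mes <= b - 1 - b / M - (2 b + r) / P,
   where r counts the sides of inner edges that do not face a full tile.  A charging argument along
   the outer boundary gives b <= (M - 2) (r + 3) <= (M - 2) (r + P), hence c* mes <= K b.
   Euler's formula requires U connected without holes; by induction on b this may be assumed.
   An arbitrary finite subgraph consists of the edges meeting the set U of its interior vertices and
   of edges joining two boundary vertices; each of the latter contributes 2 to the boundary degree
   and satisfies c* |e| <= K. *)

theory Submission
  imports Defs
begin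

text \<open>The term 1 / ((M - 2) P) of K comes from the 1 in Euler's formula: the bound for c mes
  turns into K b as soon as b / ((M - 2) P) <= 1 + r / P, that is b <= (M - 2) (r + P). In the
  charging argument M serves as a bound for the degrees, and P enters through P >= 3. If M or P is
  infinite the term vanishes and nothing has to be charged, so the charging may assume that all
  tiles are bounded. Edges are arbitrary arcs, so counting the faces of an induced subgraph would be
  a topological problem of its own. It is replaced by counting dimensions over GF(2), which yields
  the inequality card I + 1 <= card U + card F for the inner edges I and the full tiles F. The
  Jordan curve theorem exhibits a cycle as the boundary modulo 2 of the tiles inside it, and the
  absence of holes makes these tiles full. The outer boundary is never traversed either. The
  charging is local: the tiles around a vertex cannot be separated into two groups of edges without
  at least two tiles, counted as sides, passing from one group to the other.\<close>

context planar_graph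
begin

section \<open>Edges, their ends, and edges leaving a finite vertex set\<close>

lemma edge_other_end:
  assumes "e \<in> E" "x \<in> e" "x \<in> V"
  obtains y where "y \<noteq> x" "y \<in> V" "e \<inter> V = {x, y}"
proof -
  obtain g where "arc g" and ends: "e \<inter> V = {pathstart g, pathfinish g}"
    using edge_arc[OF assms(1)] by blast
  then have neq: "pathstart g \<noteq> pathfinish g" by (metis arc_distinct_ends)
  have V: "pathstart g \<in> V" "pathfinish g \<in> V" using ends by blast+
  consider "x = pathstart g" | "x = pathfinish g" using ends assms by blast
  then show thesis
  proof cases
    case 1
    then show thesis using that[of "pathfinish g"] neq V ends by simp
  next
    case 2
    then show thesis using that[of "pathstart g"] neq V ends by (simp add: insert_commute)
  qed
qed

lemma card_ends: "e \<in> E \<Longrightarrow> card (e \<inter> V) = 2"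
  using edge_arc[of e] by (metis arc_distinct_ends card_2_iff)

lemma finite_ends: "e \<in> E \<Longrightarrow> finite (e \<inter> V)"
  using edge_arc[of e] by (metis finite.emptyI finite.insertI)

lemma ends_nonempty: "e \<in> E \<Longrightarrow> \<exists>x\<in>V. x \<in> e"
  using edge_arc[of e] by auto

lemma closed_edge: "e \<in> E \<Longrightarrow> closed e"
  using edge_arc[of e] by (metis arc_imp_path closed_path_image)

lemma connected_edge: "e \<in> E \<Longrightarrow> connected e"
  using edge_arc[of e] by (metis arc_imp_path connected_path_image)

text \<open>An arc contained in \<open>V\<close> would be a connected set of two points. Points off
  \<open>V\<close> lie on at most one edge, so such a witness allows edges and their tiles to be
  compared pointwise.\<close>

lemma nonvertex_point:
  assumes "e \<in> E"
  obtains x where "x \<in> e" "x \<notin> V"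
proof -
  have "\<not> e \<subseteq> V"
  proof
    assume "e \<subseteq> V"
    then have "e \<inter> V = e" by blast
    then have "finite e" "card e = 2" using finite_ends[OF assms] card_ends[OF assms] by simp_all
    then show False using connected_finite_iff_sing[OF connected_edge[OF assms]] by auto
  qed
  then show thesis using that by blast
qed

lemma edge_eqI: "e \<in> E \<Longrightarrow> e' \<in> E \<Longrightarrow> x \<in> e \<Longrightarrow> x \<in> e' \<Longrightarrow> x \<notin> V \<Longrightarrow> e = e'"
  using edges_meet[of e e'] by blast


text \<open>Some vertex lies outside \<open>A\<close> because \<open>V\<close> is infinite, and a
  path to it has to leave \<open>A\<close>. Hence finite nonempty vertex sets always have cut edges,
  which makes the later induction on their number descend.\<close>

lemma leaving_edge:
  assumes "finite A" "A \<subseteq> V" "A \<noteq> {}"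
  obtains e x y where "e \<in> E" "e \<inter> V = {x, y}" "x \<in> A" "y \<in> V - A"
proof -
  obtain a b where ab: "a \<in> A" "b \<in> V - A"
    using assms infinite_vertices by (metis Diff_eq_empty_iff all_not_in_conv finite_subset)
  have "(a, b) \<in> {(x, y). \<exists>e\<in>E. joins V e x y}\<^sup>*"
    using connected ab assms(2) unfolding connected_graph_def by blast
  then have "b \<in> A \<or> (\<exists>x\<in>A. \<exists>y\<in>V - A. \<exists>e\<in>E. e \<inter> V = {x, y})"
  proof (induction rule: rtrancl_induct)
    case base
    then show ?case using ab by simp
  next
    case (step y z)
    then obtain e where "e \<in> E" "e \<inter> V = {y, z}" by (auto simp: joins_def)
    moreover from this have "z \<in> A \<or> z \<in> V - A" by blast
    ultimately show ?case using step.IH by blast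
  qed
  then show thesis using ab that by blast
qed

end

context tessellating_graph
begin

section \<open>Tiles, their regions and their boundary edges\<close>

lemma vertex_edge:
  assumes "v \<in> V" obtains e where "e \<in> E" "v \<in> e"
proof -
  have "incident_edges E v \<noteq> {}" using degree_ge_3[OF assms] by (auto simp: degree_in_def)
  then show thesis using that by (auto simp: incident_edges_def)
qed

lemma support_eq: "support V E = \<Union>E"
  unfolding support_def using vertex_edge by blast

lemma finite_edge_tiles: "e \<in> E \<Longrightarrow> finite (edge_tiles V E e)"
  using edge_two_tiles[of e] by (metis card.infinite zero_neq_numeral)

lemma edge_tiles_iff: "e \<in> E \<Longrightarrow> T \<in> edge_tiles V E e \<longleftrightarrow> T \<in> tiles V E \<and> e \<in> tile_edges E T"
  by (auto simp: edge_tiles_def tile_edges_def)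

lemma closed_tile: "T \<in> tiles V E \<Longrightarrow> closed T"
  by (auto simp: tiles_def)

lemma tile_edges_subset: "tile_edges E T \<subseteq> E"
  by (auto simp: tile_edges_def)

lemma edge_subset_tile: "T \<in> tiles V E \<Longrightarrow> e \<in> tile_edges E T \<Longrightarrow> e \<subseteq> T"
  using closed_tile[of T] frontier_subset_closed unfolding tile_edges_def by blast

lemma open_region: "C \<in> components (- support V E) \<Longrightarrow> open C"
  using closed_support open_components by blast

lemma region_containing:
  assumes "x \<notin> support V E"
  obtains C where "C \<in> components (- support V E)" "x \<in> C"
  using assms that[OF componentsI[of x "- support V E"]] by simp

text \<open>Components of the complement are open and disjoint, so the closure of one cannot enter
  another. This recovers the region from its tile.\<close>

lemma region_eq:
  assumes "C \<in> components (- support V E)"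
  shows "closure C - support V E = C"
proof
  show "C \<subseteq> closure C - support V E"
    using in_components_subset[OF assms] closure_subset by blast
  show "closure C - support V E \<subseteq> C"
  proof
    fix x assume x: "x \<in> closure C - support V E"
    then obtain D where D: "D \<in> components (- support V E)" "x \<in> D"
      using region_containing by blast
    then have "D \<inter> C \<noteq> {}"
      using x open_region[OF D(1)] open_Int_closure_eq_empty by blast
    then show "x \<in> C" using D assms components_eq by blast
  qed
qed

lemma tile_region:
  assumes "T \<in> tiles V E"
  shows "T - support V E \<in> components (- support V E)" "closure (T - support V E) = T"
  using assms region_eq by (auto simp: tiles_def)

text \<open>A priori an edge could be a slit inside the closure of a region. But every edge has a
  second tile, and its region would accumulate at an interior point of \<open>T\<close> and
  therefore overlap the region of \<open>T\<close>.\<close>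

lemma frontier_tile:
  assumes "T \<in> tiles V E"
  shows "frontier T = T \<inter> support V E"
proof
  let ?C = "T - support V E"
  have "?C \<subseteq> interior T"
    using open_region[OF tile_region(1)[OF assms]] by (simp add: interior_maximal)
  then show "frontier T \<subseteq> T \<inter> support V E"
    using closed_tile[OF assms] by (auto simp: frontier_def)
  show "T \<inter> support V E \<subseteq> frontier T"
  proof
    fix x assume x: "x \<in> T \<inter> support V E"
    then obtain e where e: "e \<in> E" "x \<in> e" using support_eq by blast
    obtain T1 where T1: "T1 \<in> edge_tiles V E e" "T1 \<noteq> T"
      using edge_two_tiles[OF e(1)] by (metis card_2_iff')
    then have t1: "T1 \<in> tiles V E" "x \<in> T1"
      using e edge_tiles_iff edge_subset_tile by blast+
    let ?C1 = "T1 - support V E"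
    have "x \<notin> interior T"
    proof
      assume "x \<in> interior T"
      moreover have "x \<in> closure ?C1" using t1 tile_region(2) by blast
      ultimately have "interior T \<inter> ?C1 \<noteq> {}"
        using open_Int_closure_eq_empty[OF open_interior] by blast
      moreover have "interior T \<inter> ?C1 \<subseteq> closure ?C"
        using tile_region(2)[OF assms] interior_subset by blast
      moreover have "open (interior T \<inter> ?C1)"
        using open_region[OF tile_region(1)[OF t1(1)]] by blast
      ultimately have "?C1 \<inter> ?C \<noteq> {}"
        using open_Int_closure_eq_empty by blast
      then have "?C1 = ?C"
        using tile_region(1)[OF assms] tile_region(1)[OF t1(1)] components_eq by blast
      then show False using tile_region(2) assms t1 T1(2) by metis
    qed
    then show "x \<in> frontier T" using x closed_tile[OF assms] by (auto simp: frontier_def)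
  qed
qed

lemma frontier_tile_edges:
  assumes "T \<in> tiles V E"
  shows "frontier T = \<Union>(tile_edges E T)"
proof -
  have "is_finite_cycle V E (frontier T) \<or> is_infinite_chain V E (frontier T)"
    using bounded_tile unbounded_tile assms by blast
  then obtain D where "D \<subseteq> E" "frontier T = \<Union>D"
    unfolding is_finite_cycle_def is_infinite_chain_def
  proof (elim disjE exE conjE, goal_cases)
    case (1 n v e)
    then show thesis using that[of "e ` {..<n}"] by blast
  next
    case (2 v e)
    then show thesis using that[of "range e"] by blast
  qed
  then show ?thesis unfolding tile_edges_def by blast
qed

text \<open>The frontier is a union of whole edges, and a point off \<open>V\<close> determines its
  edge; so touching \<open>e\<close> between its ends is enough.\<close>

lemma tile_nonvertex:
  assumes "T \<in> tiles V E" "x \<in> T" "e \<in> E" "x \<in> e" "x \<notin> V"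
  shows "T \<in> edge_tiles V E e"
proof -
  have "x \<in> frontier T" using assms frontier_tile support_eq by blast
  then obtain e' where e': "e' \<in> tile_edges E T" "x \<in> e'"
    using frontier_tile_edges assms(1) by blast
  then have "e' = e" using edge_eqI[of e' e x] tile_edges_subset assms by blast
  then show ?thesis using edge_tiles_iff assms(1,3) e'(1) by blast
qed

lemma tile_vertex:
  assumes "T \<in> tiles V E" "v \<in> T" "v \<in> V"
  obtains e where "e \<in> tile_edges E T" "v \<in> e"
proof -
  have "v \<in> frontier T" using assms frontier_tile by (simp add: support_def)
  then show thesis using that frontier_tile_edges[OF assms(1)] by blast
qed

lemma tiles_cover: "\<exists>T\<in>tiles V E. x \<in> T"
proof (cases "x \<in> support V E")
  case True
  then obtain e where e: "e \<in> E" "x \<in> e" using support_eq by blast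
  obtain T where T: "T \<in> edge_tiles V E e"
    using edge_two_tiles[OF e(1)] by (metis card_2_iff')
  then show ?thesis using e edge_tiles_iff edge_subset_tile by blast
next
  case False
  then obtain C where "C \<in> components (- support V E)" "x \<in> C"
    using region_containing by blast
  moreover from this have "x \<in> closure C" using closure_subset by blast
  ultimately show ?thesis unfolding tiles_def by blast
qed

lemma tiles_inter:
  assumes "T \<in> tiles V E" "T' \<in> tiles V E" "T \<noteq> T'"
  shows "T \<inter> T' \<subseteq> support V E"
proof
  fix x assume x: "x \<in> T \<inter> T'"
  show "x \<in> support V E"
  proof (rule ccontr)
    assume "x \<notin> support V E"
    then have "(T - support V E) \<inter> (T' - support V E) \<noteq> {}" using x by blast
    then have "T - support V E = T' - support V E"
      using components_eq[OF tile_region(1)[OF assms(1)] tile_region(1)[OF assms(2)]] by blast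
    then show False using tile_region(2) assms by metis
  qed
qed

lemma bounded_tile_cycle:
  assumes "T \<in> tiles V E" "bounded T"
  shows "finite (tile_edges E T)" "3 \<le> card (tile_edges E T)"
    and "v \<in> V \<Longrightarrow> v \<in> T \<Longrightarrow> card {e \<in> tile_edges E T. v \<in> e} = 2"
proof -
  obtain n w d where n: "n \<ge> 3" and w: "inj_on w {..<n}"
    and d: "\<And>i. i < n \<Longrightarrow> d i \<in> E" "\<And>i. i < n \<Longrightarrow> d i \<inter> V = {w i, w (Suc i mod n)}"
    and fr: "frontier T = (\<Union>i<n. d i)"
    using bounded_tile[OF assms] unfolding is_finite_cycle_def joins_def by blast
  have te: "tile_edges E T = d ` {..<n}"
  proof
    show "d ` {..<n} \<subseteq> tile_edges E T" using d fr by (auto simp: tile_edges_def)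
    show "tile_edges E T \<subseteq> d ` {..<n}"
    proof
      fix e assume "e \<in> tile_edges E T"
      then have e: "e \<in> E" "e \<subseteq> (\<Union>i<n. d i)" using fr by (auto simp: tile_edges_def)
      obtain x where x: "x \<in> e" "x \<notin> V" using nonvertex_point[OF e(1)] .
      then obtain i where "i < n" "x \<in> d i" using e by blast
      then show "e \<in> d ` {..<n}" using edge_eqI[OF e(1) d(1) x(1)] x by blast
    qed
  qed
  have weq: "w i = w j \<longleftrightarrow> i = j" if "i < n" "j < n" for i j
    using w that by (auto simp: inj_on_def)
  have inj: "inj_on d {..<n}"
  proof (rule inj_onI)
    fix i j assume ij: "i \<in> {..<n}" "j \<in> {..<n}" "d i = d j"
    then have "{w i, w (Suc i mod n)} = {w j, w (Suc j mod n)}" using d(2)[of i] d(2)[of j] by simp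
    then have "w i = w j \<or> (w i = w (Suc j mod n) \<and> w (Suc i mod n) = w j)"
      by (auto simp: doubleton_eq_iff)
    moreover have "Suc i mod n < n" "Suc j mod n < n" using n by auto
    ultimately have "i = j \<or> (i = Suc j mod n \<and> Suc i mod n = j)" using ij weq by simp
    \<comment> \<open>The second alternative would make \<open>n\<close> divide 2, which
      \<open>n \<ge> 3\<close> excludes.\<close>
    then show "i = j" using n ij by (auto simp: mod_Suc split: if_splits)
  qed
  show "finite (tile_edges E T)" "3 \<le> card (tile_edges E T)"
    using te n inj by (auto simp: card_image)
  assume v: "v \<in> V" "v \<in> T"
  obtain e where "e \<in> tile_edges E T" "v \<in> e" using tile_vertex[OF assms(1) v(2,1)] .
  then obtain i where i: "i < n" "v \<in> d i" using te by auto
  then have "v = w i \<or> v = w (Suc i mod n)" using d(2)[OF i(1)] v(1) by blast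
  then obtain k where k: "k < n" "v = w k" using i n by (metis mod_less_divisor not_numeral_le_zero gr0I)
  have mem: "v \<in> d j \<longleftrightarrow> j = k \<or> Suc j mod n = k" if "j < n" for j
  proof -
    have "v \<in> d j \<longleftrightarrow> v = w j \<or> v = w (Suc j mod n)" using d(2)[OF that] v(1) by blast
    then show ?thesis using k weq[of k j] weq[of k "Suc j mod n"] that by auto
  qed
  \<comment> \<open>The predecessor of \<open>k\<close> modulo \<open>n\<close>: the two boundary
    edges at \<open>w k\<close> are \<open>d k\<close> and \<open>d k'\<close>.\<close>
  define k' where "k' = (if k = 0 then n - 1 else k - 1)"
  have "{e \<in> tile_edges E T. v \<in> e} = d ` {k, k'}"
  proof -
    have "{e \<in> tile_edges E T. v \<in> e} = d ` {j. j < n \<and> (j = k \<or> Suc j mod n = k)}"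
      using te mem by auto
    also have "{j. j < n \<and> (j = k \<or> Suc j mod n = k)} = {k, k'}"
      using k n by (auto simp: k'_def mod_Suc split: if_splits)
    finally show ?thesis .
  qed
  moreover have "k' < n" "k' \<noteq> k" using k n by (auto simp: k'_def)
  ultimately show "card {e \<in> tile_edges E T. v \<in> e} = 2"
    using inj k by (auto simp: card_insert_if inj_on_def)
qed

end

context planar_graph
begin

section \<open>Inner edges, cut edges, and cycles in even edge sets\<close>

definition inner_edges :: "complex set \<Rightarrow> complex set set" where
  "inner_edges U = {e \<in> E. e \<inter> V \<subseteq> U}"

definition cut_edges :: "complex set \<Rightarrow> complex set set" where
  "cut_edges U = {e \<in> E. e \<inter> U \<noteq> {} \<and> \<not> e \<inter> V \<subseteq> U}"

definition full_tiles :: "complex set \<Rightarrow> complex set set" where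
  "full_tiles U = {T \<in> tiles V E. bounded T \<and> tile_edges E T \<subseteq> inner_edges U}"

lemma inner_cut_edges:
  "U \<subseteq> V \<Longrightarrow> inner_edges U \<union> cut_edges U = {e \<in> E. e \<inter> U \<noteq> {}}"
  "inner_edges U \<inter> cut_edges U = {}"
  using ends_nonempty by (fastforce simp: inner_edges_def cut_edges_def)+

lemma finite_incident:
  assumes "finite U" "U \<subseteq> V" shows "finite {e \<in> E. e \<inter> U \<noteq> {}}"
proof -
  have "{e \<in> E. e \<inter> U \<noteq> {}} \<subseteq> (\<Union>v\<in>U. incident_edges E v)"
    by (auto simp: incident_edges_def)
  moreover have "finite (\<Union>v\<in>U. incident_edges E v)" using assms locally_finite by blast
  ultimately show ?thesis by (rule finite_subset)
qed

lemma finite_inner_cut: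
  assumes "finite U" "U \<subseteq> V" shows "finite (inner_edges U)" "finite (cut_edges U)"
  using finite_incident[OF assms] inner_cut_edges(1)[OF assms(2)] by (metis finite_Un)+

lemma handshake:
  assumes "finite F" "finite A"
  shows "(\<Sum>v\<in>A. degree_in F v) = (\<Sum>e\<in>F. card (e \<inter> A))"
proof -
  have "(\<Sum>v\<in>A. degree_in F v) = (\<Sum>v\<in>A. \<Sum>e\<in>F. if v \<in> e then 1 else 0)"
    using assms by (simp add: degree_in_def incident_edges_def sum.If_cases Int_def)
  also have "\<dots> = (\<Sum>e\<in>F. \<Sum>v\<in>A. if v \<in> e then 1 else 0)" by (rule sum.swap)
  also have "\<dots> = (\<Sum>e\<in>F. card (e \<inter> A))"
    using assms by (simp add: sum.If_cases Int_def conj_commute)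
  finally show ?thesis .
qed

lemma edge_arc_from:
  assumes "e \<in> E" "e \<inter> V = {x, y}"
  obtains g where "arc g" "path_image g = e" "pathstart g = x" "pathfinish g = y"
proof -
  obtain g where g: "arc g" "path_image g = e" "e \<inter> V = {pathstart g, pathfinish g}"
    using edge_arc[OF assms(1)] by blast
  then consider "pathstart g = x" "pathfinish g = y" | "pathstart g = y" "pathfinish g = x"
    using assms(2) by (metis doubleton_eq_iff)
  then show thesis
  proof cases
    case 1 then show thesis using that g by blast
  next
    case 2 then show thesis using that[of "reversepath g"] g by (simp add: arc_reversepath)
  qed
qed

text \<open>If \<open>e\<close> were a bridge of \<open>Z\<close>, the degrees on one side of it
  would have an odd sum. So the ends of \<open>e\<close> stay connected in \<open>Z - {e}\<close>,
  and a shortest path between them closes up with \<open>e\<close> to a Jordan curve.\<close>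

lemma cycle_through_edge:
  assumes "finite Z" "Z \<subseteq> E" "\<And>v. v \<in> V \<Longrightarrow> even (degree_in Z v)" "e \<in> Z"
  obtains C c where "C \<subseteq> Z" "e \<in> C" "simple_path c" "pathfinish c = pathstart c"
    "path_image c = \<Union>C"
proof -
  have eE: "e \<in> E" using assms by blast
  then obtain x where x: "x \<in> e" "x \<in> V" using ends_nonempty by blast
  then obtain y where y: "y \<noteq> x" "y \<in> V" and exy: "e \<inter> V = {x, y}"
    using edge_other_end eE by metis
  define R where "R = {(a, b). \<exists>f\<in>Z - {e}. f \<inter> V = {a, b}}"
  define A where "A = {v. (x, v) \<in> R\<^sup>*}"
  have step: "b \<in> A" if "a \<in> A" "f \<in> Z - {e}" "f \<inter> V = {a, b}" for a b f
  proof -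
    have "(a, b) \<in> R" using that by (auto simp: R_def)
    then show ?thesis using that(1) by (auto simp: A_def intro: rtrancl_into_rtrancl)
  qed
  have "A \<subseteq> {x} \<union> (\<Union>f\<in>Z. f \<inter> V)"
  proof
    fix v assume "v \<in> A"
    then have "(x, v) \<in> R\<^sup>*" by (simp add: A_def)
    then show "v \<in> {x} \<union> (\<Union>f\<in>Z. f \<inter> V)"
      by (cases rule: rtrancl.cases) (auto simp: R_def)
  qed
  moreover have "finite ({x} \<union> (\<Union>f\<in>Z. f \<inter> V))"
    using assms(1,2) finite_ends by (intro finite_UnI finite_UN_I) blast+
  ultimately have finA: "finite A" and AV: "A \<subseteq> V" using x by (auto intro: finite_subset)
  have yA: "y \<in> A"
  proof (rule ccontr)
    assume "y \<notin> A"
    \<comment> \<open>\<open>A\<close> is the component of \<open>x\<close> in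
      \<open>Z - {e}\<close>: every edge of \<open>Z\<close> other than \<open>e\<close> has no or
      two ends in it, while \<open>e\<close> has exactly one.\<close>
    have "even (\<Sum>v\<in>A. degree_in Z v)" using assms(3) AV by (auto intro!: dvd_sum)
    then have "even (\<Sum>f\<in>Z. card (f \<inter> A))" using handshake[OF assms(1) finA] by simp
    moreover have "(\<Sum>f\<in>Z. card (f \<inter> A)) = card (e \<inter> A) + (\<Sum>f\<in>Z - {e}. card (f \<inter> A))"
      using assms by (simp add: sum.remove)
    moreover have "e \<inter> A = {x}"
      using exy \<open>y \<notin> A\<close> AV by (auto simp: A_def)
    moreover have "even (card (f \<inter> A))" if f: "f \<in> Z - {e}" for f
    proof (cases "f \<inter> A = {}")
      case False
      then obtain a where a: "a \<in> f" "a \<in> A" by blast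
      have "f \<in> E" using f assms by blast
      then obtain b where b: "f \<inter> V = {a, b}" "b \<noteq> a" using edge_other_end[of f a] a AV by (metis subsetD)
      have "b \<in> A" using step[OF a(2) f b(1)] .
      then have "f \<inter> A = {a, b}" using a(2) AV b(1) by blast
      then show ?thesis using b(2) by simp
    qed simp
    then have "even (\<Sum>f\<in>Z - {e}. card (f \<inter> A))" by (auto intro!: dvd_sum)
    ultimately show False by simp
  qed
  \<comment> \<open>The distance from \<open>x\<close> in \<open>Z - {e}\<close>. Bounding
    \<open>d\<close> on the vertices of the arc built so far shows that the next vertex is new, so
    the extended path is again an arc. The induction starts at distance 1 because a constant path is
    not an arc.\<close>
  define d where "d v = (LEAST n. (x, v) \<in> R ^^ n)" for v
  have dR: "(x, v) \<in> R ^^ d v" if "v \<in> A" for v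
    unfolding d_def using that rtrancl_power[of "(x, v)" R] by (auto simp: A_def intro: LeastI)
  have dle: "d v \<le> n" if "(x, v) \<in> R ^^ n" for v n
    unfolding d_def using that by (rule Least_le)
  have "v \<in> A \<Longrightarrow> d v = Suc n \<Longrightarrow> \<exists>g F. F \<subseteq> Z - {e} \<and> arc g \<and> pathstart g = x \<and> pathfinish g = v
      \<and> path_image g = \<Union>F \<and> (\<forall>w\<in>V \<inter> path_image g. d w \<le> Suc n)" for v n
  proof (induction n arbitrary: v)
    case 0
    then have "(x, v) \<in> R" using dR[of v] by simp
    then obtain f where f: "f \<in> Z - {e}" "f \<inter> V = {x, v}" by (auto simp: R_def)
    then have "f \<in> E" using assms by blast
    then obtain g where g: "arc g" "path_image g = f" "pathstart g = x" "pathfinish g = v"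
      using edge_arc_from f by blast
    moreover have "d w \<le> Suc 0" if "w \<in> V" "w \<in> f" for w
    proof -
      have "w = x \<or> w = v" using f(2) that by blast
      then show ?thesis using dle[of x 0] 0 by auto
    qed
    ultimately show ?case using f(1) by (intro exI[of _ g] exI[of _ "{f}"]) auto
  next
    case (Suc n)
    then have "(x, v) \<in> R ^^ Suc (Suc n)" using dR[of v] by simp
    then obtain z where z: "(x, z) \<in> R ^^ Suc n" "(z, v) \<in> R" by (metis relpow_Suc_E)
    then have zA: "z \<in> A" unfolding A_def by (auto simp only: mem_Collect_eq intro: relpow_imp_rtrancl)
    then have "(x, v) \<in> R ^^ Suc (d z)" using dR z(2) by auto
    then have "d z = Suc n" using dle[OF z(1)] dle[of v "Suc (d z)"] Suc.prems by simp
    then obtain g F where g: "F \<subseteq> Z - {e}" "arc g" "pathstart g = x" "pathfinish g = z"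
      "path_image g = \<Union>F" "\<forall>w\<in>V \<inter> path_image g. d w \<le> Suc n"
      using Suc.IH[OF zA] by blast
    obtain f where f: "f \<in> Z - {e}" "f \<inter> V = {z, v}" using z(2) by (auto simp: R_def)
    then have fE: "f \<in> E" using assms by blast
    obtain h where h: "arc h" "path_image h = f" "pathstart h = z" "pathfinish h = v"
      using edge_arc_from[OF fE f(2)] .
    have vV: "v \<in> V" using AV Suc.prems by blast
    have vg: "v \<notin> \<Union>F"
    proof
      assume "v \<in> \<Union>F"
      then have "d v \<le> Suc n" using g(5,6) vV by simp
      then show False using Suc.prems(2) by simp
    qed
    have "\<Union>F \<inter> f \<subseteq> {z}"
    proof
      fix w assume w: "w \<in> \<Union>F \<inter> f"
      then obtain f' where f': "f' \<in> F" "w \<in> f'" by blast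
      have "f' \<noteq> f" using vg f f'(1) by blast
      moreover have "f' \<in> E" using f' g(1) assms(2) by blast
      ultimately have "w \<in> V" using edges_meet fE f' w by blast
      then show "w \<in> {z}" using w f(2) vg by blast
    qed
    then have "arc (g +++ h)" using g h by (intro arc_join) auto
    moreover have "path_image (g +++ h) = \<Union>(insert f F)"
      using g h by (auto simp: path_image_join)
    moreover have "d w \<le> Suc (Suc n)" if "w \<in> V" "w \<in> \<Union>(insert f F)" for w
    proof (cases "w \<in> f")
      case True
      then have "w = z \<or> w = v" using f(2) that(1) by blast
      then show ?thesis using \<open>d z = Suc n\<close> Suc.prems(2) by auto
    next
      case False
      then show ?thesis using g(5,6) that by force
    qed
    ultimately show ?case using g h f
      by (intro exI[of _ "g +++ h"] exI[of _ "insert f F"]) auto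
  qed
  moreover have "d y \<noteq> 0" using dR[OF yA] y(1) by (cases "d y") auto
  ultimately obtain g F where g: "F \<subseteq> Z - {e}" "arc g" "pathstart g = x" "pathfinish g = y"
      "path_image g = \<Union>F"
    using yA by (metis not0_implies_Suc)
  obtain h where h: "arc h" "path_image h = e" "pathstart h = y" "pathfinish h = x"
    using edge_arc_from[OF eE, of y x] exy by (metis insert_commute)
  have "\<Union>F \<inter> e \<subseteq> {x, y}"
  proof -
    have "w \<in> V" if "w \<in> e" "f \<in> F" "w \<in> f" for w f
      using edges_meet[OF eE, of f] that g(1) assms(2) by blast
    then show ?thesis using exy by blast
  qed
  then have "simple_path (g +++ h)" using g h by (intro simple_path_join_loop) auto
  moreover have "path_image (g +++ h) = \<Union>(insert e F)"
    using g h by (auto simp: path_image_join)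
  ultimately show thesis using that[of "insert e F" "g +++ h"] g h assms(4) by auto
qed

end

context tessellating_graph
begin

section \<open>Jordan curves and boundaries of tile sets modulo 2\<close>

text \<open>Meant for the inside and the outside of a cycle of the graph: a region is connected and
  misses the graph, so it lies on a single side.\<close>

lemma region_side:
  assumes T: "T \<in> tiles V E" and W: "open W" "open W'" "W \<inter> W' = {}" "- support V E \<subseteq> W \<union> W'"
    and x: "x \<in> T" "x \<in> W"
  shows "T - support V E \<subseteq> W"
proof -
  let ?C = "T - support V E"
  have "x \<in> closure ?C" using tile_region(2)[OF T] x by simp
  then have "W \<inter> ?C \<noteq> {}" using open_Int_closure_eq_empty[OF W(1)] x by blast
  moreover have "connected ?C" using in_components_connected[OF tile_region(1)[OF T]] .
  ultimately show ?thesis using connectedD[of ?C W W'] W by blast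
qed

text \<open>Only finitely many tiles on the side \<open>W\<close> come near \<open>x\<close>. Their
  union is closed and covers \<open>W\<close> near \<open>x\<close>, so it contains the limit point
  \<open>x\<close> of \<open>W\<close>.\<close>

lemma tile_on_side:
  assumes W: "open W" "open W'" "W \<inter> W' = {}" "- support V E \<subseteq> W \<union> W'" and x: "x \<in> closure W"
  obtains T where "T \<in> tiles V E" "x \<in> T" "T - support V E \<subseteq> W"
proof -
  define D where "D = {T \<in> tiles V E. T \<inter> cball x 1 \<noteq> {} \<and> T - support V E \<subseteq> W}"
  have "finite D"
    using tiles_locally_finite[OF compact_cball, of x 1] unfolding D_def
    by (rule finite_subset[rotated]) blast
  then have "closed (\<Union>D)" using closed_tile by (intro closed_Union) (auto simp: D_def)
  moreover have "ball x 1 \<inter> W \<subseteq> \<Union>D"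
  proof
    fix z assume z: "z \<in> ball x 1 \<inter> W"
    obtain T where T: "T \<in> tiles V E" "z \<in> T" using tiles_cover by blast
    then have "T - support V E \<subseteq> W" using region_side[OF T(1) W T(2)] z by blast
    then show "z \<in> \<Union>D" using T z ball_subset_cball unfolding D_def by blast
  qed
  moreover have "x \<in> closure (ball x 1 \<inter> W)"
    using open_Int_closure_subset[of "ball x 1" W] x by auto
  ultimately have "x \<in> \<Union>D" using closure_minimal by blast
  then show thesis using that unfolding D_def by blast
qed

text \<open>The edge set is the boundary modulo 2 of the set \<open>S\<close> of tiles. A bounded
  tile has zero or two edges at \<open>v\<close>, so the incidences between edges at
  \<open>v\<close> and tiles of \<open>S\<close> are even in number.\<close>

lemma even_boundary:
  assumes "finite S" "S \<subseteq> tiles V E" "\<And>T. T \<in> S \<Longrightarrow> bounded T" "v \<in> V"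
  shows "even (degree_in {e \<in> E. odd (card (edge_tiles V E e \<inter> S))} v)"
proof -
  let ?I = "incident_edges E v"
  have finI: "finite ?I" using locally_finite assms by blast
  have "(\<Sum>e\<in>?I. card (edge_tiles V E e \<inter> S)) = (\<Sum>e\<in>?I. \<Sum>T\<in>S. if T \<in> edge_tiles V E e then 1 else 0)"
    using assms(1) by (simp add: sum.If_cases Int_commute)
  also have "\<dots> = (\<Sum>T\<in>S. \<Sum>e\<in>?I. if T \<in> edge_tiles V E e then 1 else 0)" by (rule sum.swap)
  also have "\<dots> = (\<Sum>T\<in>S. card {e \<in> tile_edges E T. v \<in> e})"
  proof (rule sum.cong[OF refl])
    fix T assume "T \<in> S"
    then have "?I \<inter> {e. T \<in> edge_tiles V E e} = {e \<in> tile_edges E T. v \<in> e}"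
      using assms(2) by (auto simp: incident_edges_def edge_tiles_def tile_edges_def)
    then show "(\<Sum>e\<in>?I. if T \<in> edge_tiles V E e then 1 else 0) = card {e \<in> tile_edges E T. v \<in> e}"
      using finI by (simp add: sum.If_cases)
  qed
  also have "even \<dots>"
  proof (rule dvd_sum)
    fix T assume T: "T \<in> S"
    show "even (card {e \<in> tile_edges E T. v \<in> e})"
    proof (cases "v \<in> T")
      case True
      then show ?thesis using bounded_tile_cycle(3)[of T v] T assms by auto
    next
      case False
      then have none: "{e \<in> tile_edges E T. v \<in> e} = {}"
        using edge_subset_tile T assms(2) by blast
      show ?thesis unfolding none by simp
    qed
  qed
  finally have "even (\<Sum>e\<in>?I. card (edge_tiles V E e \<inter> S))" .
  then have "even (card {e \<in> ?I. odd (card (edge_tiles V E e \<inter> S))})"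
    using even_sum_iff[OF finI, of "\<lambda>e. card (edge_tiles V E e \<inter> S)"] by simp
  moreover have "{e \<in> ?I. odd (card (edge_tiles V E e \<inter> S))}
      = incident_edges {e \<in> E. odd (card (edge_tiles V E e \<inter> S))} v"
    by (auto simp: incident_edges_def)
  ultimately show ?thesis by (simp add: degree_in_def)
qed

text \<open>\<open>S\<close> consists of the tiles inside the Jordan curve formed by
  \<open>C\<close>. Hypothesis \<open>fill\<close> says that \<open>U\<close> has no holes; it
  forces all vertices inside the curve into \<open>U\<close>, and this makes the tiles of
  \<open>S\<close> full.\<close>

lemma cycle_bounds_tiles:
  assumes C: "C \<subseteq> E" and c: "simple_path c" "pathfinish c = pathstart c" "path_image c = \<Union>C"
    and U: "U \<subseteq> V" "C \<subseteq> inner_edges U"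
    and fill: "\<And>W. finite W \<Longrightarrow> W \<noteq> {} \<Longrightarrow> W \<subseteq> V - U \<Longrightarrow>
      \<exists>e\<in>E. e \<inter> W \<noteq> {} \<and> \<not> e \<inter> V \<subseteq> U \<union> W"
  obtains S where "S \<subseteq> full_tiles U" "C = {e \<in> E. odd (card (edge_tiles V E e \<inter> S))}"
proof -
  let ?J = "\<Union>C"
  let ?I = "inside ?J" and ?O = "outside ?J"
  have J: "open ?I" "open ?O" "bounded ?I" "?I \<inter> ?O = {}" "?I \<union> ?O = - ?J"
    "frontier ?I = ?J" "frontier ?O = ?J"
    using Jordan_inside_outside[OF c(1,2)] unfolding c(3) by blast+
  have OI: "?O \<inter> ?I = {}" using J(4) by blast
  have Jsup: "- support V E \<subseteq> ?I \<union> ?O" "- support V E \<subseteq> ?O \<union> ?I"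
    using C J(5) support_eq by blast+
  define S where "S = {T \<in> tiles V E. T - support V E \<subseteq> ?I}"
  have inS: "T \<in> S" if "T \<in> tiles V E" "x \<in> T" "x \<in> ?I" for T x
    using region_side[OF that(1) J(1,2,4) Jsup(1) that(2,3)] that(1) by (simp add: S_def)
  have nonempty: "T - support V E \<noteq> {}" if "T \<in> tiles V E" for T
    using in_components_nonempty tile_region(1) that by blast
  have outS: "T \<notin> S" if "T \<in> tiles V E" "T - support V E \<subseteq> ?O" for T
    using nonempty[OF that(1)] that J(4) unfolding S_def by blast
  have Sbd: "bounded T \<and> T \<subseteq> ?I \<union> ?J" if "T \<in> S" for T
  proof -
    have T: "T \<in> tiles V E" "T - support V E \<subseteq> ?I" using that by (auto simp: S_def)
    then have "T \<subseteq> closure ?I" using tile_region(2) closure_mono by metis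
    moreover have "closure ?I = ?I \<union> ?J" using J(1,6) closure_Un_frontier by metis
    moreover have "bounded (closure ?I)" using J(3) by (rule bounded_closure)
    ultimately show ?thesis using bounded_subset by metis
  qed
  have finS: "finite S"
  proof -
    have "compact (closure ?I)" using J(3) by (simp add: compact_closure)
    moreover have "S \<subseteq> {T \<in> tiles V E. T \<inter> closure ?I \<noteq> {}}"
    proof
      fix T assume "T \<in> S"
      then have T: "T \<in> tiles V E" "T - support V E \<subseteq> ?I" by (auto simp: S_def)
      then show "T \<in> {T \<in> tiles V E. T \<inter> closure ?I \<noteq> {}}"
        using nonempty[OF T(1)] closure_subset[of ?I] by blast
    qed
    ultimately show ?thesis using tiles_locally_finite finite_subset by blast
  qed
  \<comment> \<open>The vertices inside the curve but not in \<open>U\<close> are finite in number,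
    since they lie on finitely many bounded tiles. If there were any, \<open>fill\<close> would give
    an edge from one of them to a vertex outside the curve; but an edge not in \<open>C\<close> can
    meet the curve only in vertices, and those belong to \<open>U\<close>.\<close>
  have VI: "V \<inter> ?I \<subseteq> U"
  proof (rule ccontr)
    assume "\<not> V \<inter> ?I \<subseteq> U"
    define W where "W = V \<inter> ?I - U"
    have "W \<subseteq> (\<Union>T\<in>S. \<Union>e\<in>tile_edges E T. e \<inter> V)"
    proof
      fix w assume w: "w \<in> W"
      obtain T where T: "T \<in> tiles V E" "w \<in> T" using tiles_cover by blast
      then have "T \<in> S" using inS w by (auto simp: W_def)
      moreover obtain e where "e \<in> tile_edges E T" "w \<in> e"
        using tile_vertex[OF T] w by (auto simp: W_def)
      ultimately show "w \<in> (\<Union>T\<in>S. \<Union>e\<in>tile_edges E T. e \<inter> V)" using w by (auto simp: W_def)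
    qed
    moreover have "finite (\<Union>T\<in>S. \<Union>e\<in>tile_edges E T. e \<inter> V)"
    proof (rule finite_UN_I[OF finS])
      fix T assume T: "T \<in> S"
      then have "finite (tile_edges E T)" using bounded_tile_cycle(1) Sbd by (auto simp: S_def)
      then show "finite (\<Union>e\<in>tile_edges E T. e \<inter> V)"
        by (rule finite_UN_I) (use tile_edges_subset finite_ends in blast)
    qed
    ultimately have "finite W" by (rule finite_subset)
    moreover have "W \<noteq> {}" "W \<subseteq> V - U" using \<open>\<not> V \<inter> ?I \<subseteq> U\<close> by (auto simp: W_def)
    ultimately obtain e where e: "e \<in> E" "e \<inter> W \<noteq> {}" "\<not> e \<inter> V \<subseteq> U \<union> W"
      using fill[of W] by metis
    then obtain w where w: "w \<in> e" "w \<in> W" by blast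
    then have wV: "w \<in> V" "w \<in> ?I" by (auto simp: W_def)
    then obtain w' where w': "e \<inter> V = {w, w'}" using edge_other_end[OF e(1) w(1)] by metis
    have nw': "w' \<notin> U" "w' \<notin> W" using e(3) w(2) unfolding w' by auto
    have "w' \<in> e \<inter> V" unfolding w' by simp
    then have nw'': "w' \<in> V" "w' \<in> e" by auto
    have "w' \<notin> ?I" using nw' nw''(1) by (simp add: W_def)
    have "w' \<notin> ?J" using nw'(1) nw''(1) U(2) by (auto simp: inner_edges_def)
    have "e \<notin> C" using wV J(5) w(1) by blast
    have "e \<inter> ?J = {}"
    proof -
      have "z \<in> V" if "z \<in> e" "f \<in> C" "z \<in> f" for z f
        using edges_meet[OF e(1), of f] that C \<open>e \<notin> C\<close> by blast
      then have "e \<inter> ?J \<subseteq> {w, w'}" unfolding w'[symmetric] by blast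
      moreover have "w \<notin> ?J" using wV(2) J(5) by blast
      ultimately show ?thesis using \<open>w' \<notin> ?J\<close> by blast
    qed
    then have "e \<subseteq> ?I \<union> ?O" using J(5) by blast
    moreover have "w' \<in> ?O" using \<open>w' \<notin> ?I\<close> \<open>w' \<notin> ?J\<close> J(5) by blast
    moreover have "?I \<inter> ?O \<inter> e = {}" using J(4) by simp
    moreover have "?I \<inter> e \<noteq> {}" using w(1) wV(2) by blast
    ultimately show False
      using connectedD[OF connected_edge[OF e(1)] J(1,2)] nw''(2) by (metis IntI empty_iff)
  qed
  have "S \<subseteq> full_tiles U"
  proof
    fix T assume T: "T \<in> S"
    have "e \<in> inner_edges U" if "e \<in> tile_edges E T" for e
    proof -
      have "e \<subseteq> T" "e \<in> E" using that T edge_subset_tile tile_edges_subset by (auto simp: S_def)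
      moreover have "V \<inter> ?J \<subseteq> U" using U by (auto simp: inner_edges_def)
      ultimately show ?thesis using VI Sbd[OF T] unfolding inner_edges_def by blast
    qed
    then show "T \<in> full_tiles U" using T Sbd by (auto simp: full_tiles_def S_def)
  qed
  \<comment> \<open>A point of \<open>e\<close> off \<open>V\<close> decides. On the curve it is a
    limit of both sides, so exactly one of the two tiles of \<open>e\<close> is inside; off the
    curve both tiles lie on the side of the point, and 0 and 2 are even.\<close>
  moreover have "e \<in> C \<longleftrightarrow> odd (card (edge_tiles V E e \<inter> S))" if e: "e \<in> E" for e
  proof -
    obtain x where x: "x \<in> e" "x \<notin> V" using nonvertex_point[OF e] .
    have mem: "T \<in> tiles V E" "x \<in> T" if "T \<in> edge_tiles V E e" for T
      using that edge_tiles_iff[OF e] edge_subset_tile x by blast+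
    show ?thesis
    proof (cases "e \<in> C")
      case True
      then have xJ: "x \<in> ?J" using x by blast
      then have "x \<in> closure ?I" "x \<in> closure ?O" using J(6,7) by (auto simp: frontier_def)
      then obtain T1 T2 where T1: "T1 \<in> tiles V E" "x \<in> T1" "T1 - support V E \<subseteq> ?I"
        and T2: "T2 \<in> tiles V E" "x \<in> T2" "T2 - support V E \<subseteq> ?O"
        using tile_on_side[OF J(1,2,4) Jsup(1)] tile_on_side[OF J(2,1) OI Jsup(2)] by metis
      then have t: "T1 \<in> edge_tiles V E e" "T2 \<in> edge_tiles V E e" "T1 \<in> S" "T2 \<notin> S"
        using tile_nonvertex e x outS by (auto simp: S_def)
      then have "T1 \<noteq> T2" by blast
      then have "card {T1, T2} = card (edge_tiles V E e)" using edge_two_tiles[OF e] by simp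
      then have "edge_tiles V E e = {T1, T2}"
        using card_subset_eq[OF finite_edge_tiles[OF e], of "{T1, T2}"] t(1,2) by simp
      then have "edge_tiles V E e \<inter> S = {T1}" using t by blast
      then show ?thesis using True by simp
    next
      case False
      have "x \<notin> ?J" using edge_eqI[OF e _ x(1) _ x(2)] C False by blast
      then consider "x \<in> ?I" | "x \<in> ?O" using J(5) by blast
      then have "edge_tiles V E e \<inter> S = edge_tiles V E e \<or> edge_tiles V E e \<inter> S = {}"
      proof cases
        case 1
        then show ?thesis using mem inS by blast
      next
        case 2
        then show ?thesis using mem outS region_side[OF _ J(2,1) OI Jsup(2)] by blast
      qed
      then show ?thesis using False edge_two_tiles[OF e] by auto
    qed
  qed
  ultimately show thesis using that[of S] C by blast
qed

end

section \<open>The cycle space over GF(2) and Euler's formula\<close>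

text \<open>Additivity over GF(2), with \<open>sym_diff\<close> as the sum. It makes both the degree
  parities of edge sets and the boundaries of tile sets additive.\<close>

lemma odd_card_sym_diff:
  assumes "finite A"
  shows "odd (card (A \<inter> sym_diff S S')) \<longleftrightarrow> odd (card (A \<inter> S)) \<noteq> odd (card (A \<inter> S'))"
proof -
  have "card (A \<inter> S) = card (A \<inter> S \<inter> S') + card (A \<inter> (S - S'))"
    using assms by (subst card_Un_disjoint[symmetric]) (auto intro: arg_cong[of _ _ card])
  moreover have "card (A \<inter> S') = card (A \<inter> S \<inter> S') + card (A \<inter> (S' - S))"
    using assms by (subst card_Un_disjoint[symmetric]) (auto intro: arg_cong[of _ _ card])
  moreover have "card (A \<inter> sym_diff S S') = card (A \<inter> (S - S')) + card (A \<inter> (S' - S))"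
    using assms by (subst card_Un_disjoint[symmetric]) (auto intro: arg_cong[of _ _ card])
  ultimately show ?thesis by auto
qed

context planar_graph
begin

lemma odd_degree_sym_diff:
  assumes "v \<in> V" "Z \<subseteq> E" "Z' \<subseteq> E"
  shows "odd (degree_in (sym_diff Z Z') v) \<longleftrightarrow> odd (degree_in Z v) \<noteq> odd (degree_in Z' v)"
proof -
  have "degree_in Y v = card (incident_edges E v \<inter> Y)" if "Y \<subseteq> E" for Y
    using that by (auto simp: degree_in_def incident_edges_def intro: arg_cong[of _ _ card])
  moreover have "sym_diff Z Z' \<subseteq> E" using assms by blast
  ultimately show ?thesis
    using odd_card_sym_diff[OF locally_finite[OF assms(1)], of Z Z'] assms(2,3) by simp
qed

end

context tessellating_graph
begin

lemma finite_full_tiles: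
  assumes "finite U" "U \<subseteq> V" shows "finite (full_tiles U)"
proof -
  have "full_tiles U \<subseteq> (\<Union>e\<in>inner_edges U. edge_tiles V E e)"
  proof
    fix T assume "T \<in> full_tiles U"
    then have T: "T \<in> tiles V E" "bounded T" "tile_edges E T \<subseteq> inner_edges U"
      by (auto simp: full_tiles_def)
    then have "tile_edges E T \<noteq> {}" using bounded_tile_cycle(2)[OF T(1,2)] by auto
    then show "T \<in> (\<Union>e\<in>inner_edges U. edge_tiles V E e)"
      using T edge_tiles_iff tile_edges_subset by blast
  qed
  moreover have "finite (\<Union>e\<in>inner_edges U. edge_tiles V E e)"
    using finite_inner_cut(1)[OF assms] finite_edge_tiles by (auto simp: inner_edges_def)
  ultimately show ?thesis by (rule finite_subset)
qed

text \<open>Over GF(2), the cycle space of the subgraph induced by U is spanned by the boundaries of the full tiles.\<close>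

lemma even_set_boundary:
  assumes U: "finite U" "U \<subseteq> V"
    and fill: "\<And>W. finite W \<Longrightarrow> W \<noteq> {} \<Longrightarrow> W \<subseteq> V - U \<Longrightarrow>
      \<exists>e\<in>E. e \<inter> W \<noteq> {} \<and> \<not> e \<inter> V \<subseteq> U \<union> W"
    and Z: "Z \<subseteq> inner_edges U" "\<And>v. v \<in> V \<Longrightarrow> even (degree_in Z v)"
  shows "\<exists>S\<subseteq>full_tiles U. Z = {e \<in> E. odd (card (edge_tiles V E e \<inter> S))}"
proof -
  have "finite Z" using finite_inner_cut(1)[OF U] Z(1) finite_subset by blast
  then show ?thesis using Z
  proof (induction Z rule: finite_psubset_induct)
    case (psubset Z)
    have ZE: "Z \<subseteq> E" using psubset.prems(1) by (auto simp: inner_edges_def)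
    show ?case
    proof (cases "Z = {}")
      case True
      then show ?thesis by (intro exI[of _ "{}"]) auto
    next
      case False
      then obtain e where "e \<in> Z" by blast
      then obtain C c where C: "C \<subseteq> Z" "e \<in> C" "simple_path c" "pathfinish c = pathstart c"
        "path_image c = \<Union>C"
        using cycle_through_edge[OF psubset.hyps ZE psubset.prems(2)] by metis
      have CE: "C \<subseteq> E" using C(1) ZE by blast
      obtain S where S: "S \<subseteq> full_tiles U" "C = {e \<in> E. odd (card (edge_tiles V E e \<inter> S))}"
        using cycle_bounds_tiles[OF CE C(3,4,5) U(2) _ fill] C(1) psubset.prems(1) by blast
      have finS: "finite S" using S(1) finite_full_tiles[OF U] by (rule finite_subset)
      have "even (degree_in C v)" if "v \<in> V" for v
        unfolding S(2) using S(1) finS that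
        by (intro even_boundary) (auto simp: full_tiles_def)
      moreover have "Z - C = sym_diff Z C" using C(1) by blast
      ultimately have "even (degree_in (Z - C) v)" if "v \<in> V" for v
        using odd_degree_sym_diff[OF that ZE CE] psubset.prems(2) that by auto
      moreover have "Z - C \<subset> Z" "Z - C \<subseteq> inner_edges U" using C psubset.prems(1) by blast+
      ultimately obtain S' where S': "S' \<subseteq> full_tiles U"
        "Z - C = {e \<in> E. odd (card (edge_tiles V E e \<inter> S'))}"
        using psubset.IH[of "Z - C"] by blast
      \<comment> \<open>\<open>Z\<close> is the GF(2) sum of \<open>C\<close> and
        \<open>Z - C\<close>, so it is bounded by the sum of the two tile sets.\<close>
      have "Z = {e \<in> E. odd (card (edge_tiles V E e \<inter> sym_diff S S'))}"
      proof (rule set_eqI)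
        fix e
        have "e \<in> Z \<longleftrightarrow> e \<in> E \<and> (e \<in> C) \<noteq> (e \<in> Z - C)" using C(1) ZE by blast
        also have "\<dots> \<longleftrightarrow> e \<in> E \<and> odd (card (edge_tiles V E e \<inter> S)) \<noteq> odd (card (edge_tiles V E e \<inter> S'))"
          using S(2) S'(2) by blast
        also have "\<dots> \<longleftrightarrow> e \<in> E \<and> odd (card (edge_tiles V E e \<inter> sym_diff S S'))"
          using odd_card_sym_diff[OF finite_edge_tiles] by blast
        finally show "e \<in> Z \<longleftrightarrow> e \<in> {e \<in> E. odd (card (edge_tiles V E e \<inter> sym_diff S S'))}" by simp
      qed
      moreover have "sym_diff S S' \<subseteq> full_tiles U" using S(1) S'(1) by blast
      ultimately show ?thesis by blast
    qed
  qed
qed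

text \<open>Euler's formula as a rank count: an edge set Z inside U is determined by the parities of its degrees
  at all vertices but u, together with a set of full tiles bounding the even set obtained by
  subtracting a fixed representative with these parities.\<close>

lemma euler_inequality:
  assumes U: "finite U" "U \<subseteq> V" "U \<noteq> {}"
    and fill: "\<And>W. finite W \<Longrightarrow> W \<noteq> {} \<Longrightarrow> W \<subseteq> V - U \<Longrightarrow>
      \<exists>e\<in>E. e \<inter> W \<noteq> {} \<and> \<not> e \<inter> V \<subseteq> U \<union> W"
  shows "card (inner_edges U) + 1 \<le> card U + card (full_tiles U)"
proof -
  let ?I = "inner_edges U"
  have finI: "finite ?I" and IE: "?I \<subseteq> E"
    using finite_inner_cut(1)[OF U(1,2)] by (auto simp: inner_edges_def)
  obtain u where u: "u \<in> U" using U(3) by blast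
  define D where "D Z = {v \<in> U - {u}. odd (degree_in Z v)}" for Z
  define rep where "rep B = (SOME Z. Z \<subseteq> ?I \<and> D Z = B)" for B
  define Y where "Y Z = sym_diff Z (rep (D Z))" for Z
  have rep: "rep (D Z) \<subseteq> ?I \<and> D (rep (D Z)) = D Z" if "Z \<subseteq> ?I" for Z
    unfolding rep_def by (rule someI[of _ Z]) (simp add: that)
  have YI: "Y Z \<subseteq> ?I" if "Z \<subseteq> ?I" for Z
    using that rep[OF that] by (auto simp: Y_def)
  have even_Y: "even (degree_in (Y Z) v)" if Z: "Z \<subseteq> ?I" and v: "v \<in> V" for Z v
  proof -
    have 1: "even (degree_in (Y Z) w)" if "w \<in> U - {u}" for w
    proof -
      have "w \<in> V" "Z \<subseteq> E" "rep (D Z) \<subseteq> E" using that U Z rep[OF Z] IE by auto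
      moreover have "w \<in> D Z \<longleftrightarrow> w \<in> D (rep (D Z))" using rep[OF Z] by blast
      ultimately show ?thesis using that odd_degree_sym_diff[of w Z "rep (D Z)"]
        by (auto simp: D_def Y_def)
    qed
    have finY: "finite (Y Z)" using finI YI[OF Z] finite_subset by blast
    \<comment> \<open>The parity at \<open>u\<close> is not recorded in \<open>D\<close>, since the
      handshake identity determines it from the others. This saves one dimension and is the 1 in the
      formula.\<close>
    have "(\<Sum>w\<in>U. degree_in (Y Z) w) = (\<Sum>e\<in>Y Z. card (e \<inter> U))" by (rule handshake[OF finY U(1)])
    also have "\<dots> = (\<Sum>e\<in>Y Z. 2)"
    proof (rule sum.cong[OF refl])
      fix e assume "e \<in> Y Z"
      then have "e \<in> E" "e \<inter> V \<subseteq> U" using YI[OF Z] by (auto simp: inner_edges_def)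
      moreover from this have "e \<inter> U = e \<inter> V" using U(2) by blast
      ultimately show "card (e \<inter> U) = 2" using card_ends by simp
    qed
    finally have "even (\<Sum>w\<in>U. degree_in (Y Z) w)" by simp
    moreover have "even (\<Sum>w\<in>U - {u}. degree_in (Y Z) w)" using 1 by (auto intro!: dvd_sum)
    ultimately have 2: "even (degree_in (Y Z) u)" using U(1) u by (simp add: sum.remove)
    show ?thesis
    proof (cases "v \<in> U")
      case True
      then show ?thesis using 1 2 by blast
    next
      case False
      then have none: "incident_edges (Y Z) v = {}"
        using YI[OF Z] v by (auto simp: incident_edges_def inner_edges_def)
      show ?thesis unfolding degree_in_def none by simp
    qed
  qed
  define bd where "bd S = {e \<in> E. odd (card (edge_tiles V E e \<inter> S))}" for S
  define F where "F Z = (SOME S. S \<subseteq> full_tiles U \<and> Y Z = bd S)" for Z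
  have F: "F Z \<subseteq> full_tiles U \<and> Y Z = bd (F Z)" if "Z \<subseteq> ?I" for Z
    unfolding F_def
    using someI_ex[of "\<lambda>S. S \<subseteq> full_tiles U \<and> Y Z = bd S"]
      even_set_boundary[OF U(1,2) fill YI[OF that] even_Y[OF that]] unfolding bd_def by blast
  \<comment> \<open>\<open>F Z\<close> determines \<open>Y Z\<close>, and adding
    \<open>rep (D Z)\<close> to it gives back \<open>Z\<close>.\<close>
  have "inj_on (\<lambda>Z. (D Z, F Z)) (Pow ?I)"
  proof (rule inj_onI)
    fix Z Z' assume Z: "Z \<in> Pow ?I" "Z' \<in> Pow ?I" "(D Z, F Z) = (D Z', F Z')"
    then have "Y Z = Y Z'" using F by simp
    then show "Z = Z'" using Z(3) unfolding Y_def by auto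
  qed
  moreover have "(\<lambda>Z. (D Z, F Z)) ` Pow ?I \<subseteq> Pow (U - {u}) \<times> Pow (full_tiles U)"
    using F by (auto simp: D_def)
  moreover have "finite (Pow (U - {u}) \<times> Pow (full_tiles U))"
    using U finite_full_tiles by simp
  ultimately have "card (Pow ?I) \<le> card (Pow (U - {u}) \<times> Pow (full_tiles U))"
    by (rule card_inj_on_le)
  also have "\<dots> = 2 ^ (card (U - {u}) + card (full_tiles U))"
    using U finite_full_tiles by (simp add: card_cartesian_product card_Pow power_add)
  finally have "card ?I \<le> card (U - {u}) + card (full_tiles U)"
    using finI by (simp add: card_Pow)
  moreover have "card U = card (U - {u}) + 1" using U(1) u by (metis Suc_eq_plus1 card_Suc_Diff1)
  ultimately show ?thesis by simp
qed

section \<open>The tiles around a vertex\<close>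

text \<open>The tiles at v with an edge in A and those with an edge outside A are two closed sets covering
  a small ball; if no tile were of both kinds, they would disconnect the punctured ball.\<close>

lemma link_connected:
  assumes bdd: "\<And>T. T \<in> tiles V E \<Longrightarrow> bounded T"
    and v: "v \<in> V" and A: "A \<subseteq> incident_edges E v" "A \<noteq> {}" "incident_edges E v - A \<noteq> {}"
  obtains T a b where "T \<in> tiles V E" "a \<in> A" "b \<in> incident_edges E v - A"
    "a \<in> tile_edges E T" "b \<in> tile_edges E T"
proof (rule ccontr)
  let ?B = "incident_edges E v - A"
  note thesisI = that
  assume "\<not> thesis"
  then have sep: False if "T \<in> tiles V E" "a \<in> A" "b \<in> ?B" "a \<in> tile_edges E T" "b \<in> tile_edges E T" for T a b
    using thesisI[OF that] \<open>\<not> thesis\<close> by blast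
  define N where "N = {T \<in> tiles V E. T \<inter> cball v 1 \<noteq> {}}"
  have finN: "finite N" unfolding N_def by (rule tiles_locally_finite) simp
  \<comment> \<open>The nearby tiles and their edges that miss \<open>v\<close>, and their vertices
    other than \<open>v\<close>. By local finiteness this is a closed set; a small ball avoiding it
    sees only tiles and edges that contain \<open>v\<close>.\<close>
  define G where "G = \<Union>{T \<in> N. v \<notin> T} \<union> (\<Union>T\<in>N. \<Union>{e \<in> tile_edges E T. v \<notin> e})
    \<union> ((\<Union>T\<in>N. \<Union>e\<in>tile_edges E T. e \<inter> V) - {v})"
  have fte: "finite (tile_edges E T)" if "T \<in> N" for T
    using bounded_tile_cycle(1) bdd that by (auto simp: N_def)
  have clN: "closed T" if "T \<in> N" for T using closed_tile that by (simp add: N_def)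
  have "closed (\<Union>{T \<in> N. v \<notin> T})"
    using finN clN by (intro closed_Union) auto
  moreover have "closed (\<Union>T\<in>N. \<Union>{e \<in> tile_edges E T. v \<notin> e})"
  proof (intro closed_UN closed_Union finN ballI)
    show "finite {e \<in> tile_edges E T. v \<notin> e}" if "T \<in> N" for T using fte[OF that] by simp
    show "closed e" if "e \<in> {e \<in> tile_edges E T. v \<notin> e}" for e T
      using that closed_edge tile_edges_subset by blast
  qed
  moreover have "finite (\<Union>T\<in>N. \<Union>e\<in>tile_edges E T. e \<inter> V)"
    using finN fte finite_ends tile_edges_subset by (intro finite_UN_I) auto
  then have "closed ((\<Union>T\<in>N. \<Union>e\<in>tile_edges E T. e \<inter> V) - {v})"
    by (intro finite_imp_closed) simp
  ultimately have "closed G" unfolding G_def by (intro closed_Un)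
  moreover have "v \<notin> G" by (auto simp: G_def)
  ultimately obtain r where r: "r > 0" "ball v r \<subseteq> - G"
    using open_contains_ball[of "- G"] by (auto simp: open_closed)
  define \<delta> where "\<delta> = min r 1"
  have \<delta>: "\<delta> > 0" "ball v \<delta> \<subseteq> - G" "ball v \<delta> \<subseteq> cball v 1" using r by (auto simp: \<delta>_def)
  let ?P = "ball v \<delta> - {v}"
  have key: "T \<in> N \<and> v \<in> T" if "x \<in> ball v \<delta>" "T \<in> tiles V E" "x \<in> T" for x T
  proof -
    have "x \<in> cball v 1" "x \<notin> G" using that(1) \<delta>(2,3) by auto
    then have "T \<in> N" using that(2,3) by (auto simp: N_def)
    then show ?thesis using \<open>x \<notin> G\<close> that(3) unfolding G_def by blast
  qed
  define X where "X D = \<Union>{T \<in> N. v \<in> T \<and> tile_edges E T \<inter> D \<noteq> {}}" for D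
  have closedX: "closed (X D)" for D
    unfolding X_def using finN clN by (intro closed_Union) auto
  have "?P \<subseteq> X A \<union> X ?B"
  proof
    fix x assume x: "x \<in> ?P"
    obtain T where T: "T \<in> tiles V E" "x \<in> T" using tiles_cover by blast
    then have T': "T \<in> N" "v \<in> T" using key x by auto
    obtain e where "e \<in> tile_edges E T" "v \<in> e" using tile_vertex[OF T(1) T'(2) v] .
    moreover from this have "e \<in> A \<or> e \<in> ?B" using tile_edges_subset by (auto simp: incident_edges_def)
    ultimately show "x \<in> X A \<union> X ?B" using T T' unfolding X_def by blast
  qed
  \<comment> \<open>A common point of two such tiles lies on an edge of both, and this edge contains
    \<open>v\<close>. Being in \<open>A\<close> or not, it makes one of the two tiles have edges of
    both kinds.\<close>
  moreover have "X A \<inter> X ?B \<inter> ?P = {}"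
  proof (rule ccontr)
    assume "X A \<inter> X ?B \<inter> ?P \<noteq> {}"
    then obtain x T T' where x: "x \<in> ?P" "x \<in> T" "x \<in> T'" and T: "T \<in> N" "v \<in> T" "tile_edges E T \<inter> A \<noteq> {}"
      and T': "T' \<in> N" "v \<in> T'" "tile_edges E T' \<inter> ?B \<noteq> {}"
      unfolding X_def by blast
    have t: "T \<in> tiles V E" "T' \<in> tiles V E" using T T' by (auto simp: N_def)
    have "T \<noteq> T'" using sep t T(3) T'(3) by blast
    then have xs: "x \<in> support V E" using tiles_inter t x by blast
    then have "x \<in> frontier T" "x \<in> frontier T'" using frontier_tile t x by blast+
    then obtain e e' where e: "e \<in> tile_edges E T" "x \<in> e" and e': "e' \<in> tile_edges E T'" "x \<in> e'"
      using frontier_tile_edges t by blast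
    have "x \<notin> V" using x(1) e T(1) \<delta>(2) unfolding G_def by blast
    then have "e = e'" using edge_eqI[of e e' x] e e' tile_edges_subset by blast
    have "v \<in> e" using x(1) e T(1) \<delta>(2) unfolding G_def by blast
    then have "e \<in> A \<or> e \<in> ?B" using e tile_edges_subset by (auto simp: incident_edges_def)
    then show False using sep t T(3) T'(3) e e' \<open>e = e'\<close> by blast
  qed
  moreover have "connected ?P" by (rule connected_punctured_ball) simp
  moreover have meets: "X D \<inter> ?P \<noteq> {}" if D: "D \<noteq> {}" "D \<subseteq> incident_edges E v" for D
  proof -
    obtain a where a: "a \<in> D" "a \<in> E" "v \<in> a" using D by (auto simp: incident_edges_def)
    obtain T where "T \<in> edge_tiles V E a" using edge_two_tiles[OF a(2)] by (metis card_2_iff')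
    then have T: "T \<in> tiles V E" "a \<in> tile_edges E T" using edge_tiles_iff a by blast+
    then have vT: "v \<in> T" using edge_subset_tile a by blast
    then have "v \<in> closure (T - support V E)" using tile_region(2)[OF T(1)] by simp
    then have "ball v \<delta> \<inter> (T - support V E) \<noteq> {}"
      using open_Int_closure_eq_empty[of "ball v \<delta>"] \<delta>(1) by (metis centre_in_ball disjoint_iff open_ball)
    then obtain z where z: "z \<in> ball v \<delta>" "z \<in> T" "z \<notin> support V E" by blast
    moreover have "z \<noteq> v" using z(3) v by (auto simp: support_def)
    moreover have "T \<in> N" using key T(1) z by blast
    ultimately show ?thesis using T(2) a(1) vT unfolding X_def by blast
  qed
  ultimately show False
    using connected_closedD[of ?P "X A" "X ?B"] closedX meets[of A] meets[of ?B] A by blast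
qed

text \<open>Every tile at \<open>v\<close> has two edges there, and every edge has two tiles, so the
  incidences of edges in \<open>A\<close> with tiles number \<open>2 * card A\<close>. Hence the
  tiles with just one of their two edges in \<open>A\<close> are even in number, and
  \<open>link_connected\<close> provides one. Sides of edges are counted rather than edges because
  \<open>A\<close> may be a single edge carrying both tiles.\<close>

lemma link_two_tiles:
  assumes bdd: "\<And>T. T \<in> tiles V E \<Longrightarrow> bounded T"
    and v: "v \<in> V" and A: "A \<subseteq> incident_edges E v" "A \<noteq> {}" "incident_edges E v - A \<noteq> {}"
  shows "2 \<le> (\<Sum>e\<in>A. card {T \<in> edge_tiles V E e. tile_edges E T \<inter> (incident_edges E v - A) \<noteq> {}})"
proof -
  let ?B = "incident_edges E v - A"
  have finA: "finite A" using A(1) locally_finite[OF v] finite_subset by blast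
  have AE: "A \<subseteq> E" using A(1) by (auto simp: incident_edges_def)
  define N where "N = (\<Union>a\<in>A. edge_tiles V E a)"
  have finN: "finite N" using finA AE finite_edge_tiles by (auto simp: N_def)
  have two: "card (tile_edges E T \<inter> incident_edges E v) = 2" if TN: "T \<in> N" for T
  proof -
    obtain a where "T \<in> tiles V E" "a \<in> A" "a \<in> tile_edges E T"
      using TN AE edge_tiles_iff unfolding N_def by blast
    moreover from this have "v \<in> T" using edge_subset_tile A(1) by (auto simp: incident_edges_def)
    moreover have "tile_edges E T \<inter> incident_edges E v = {e \<in> tile_edges E T. v \<in> e}"
      using tile_edges_subset by (auto simp: incident_edges_def)
    ultimately show ?thesis using bounded_tile_cycle(3)[of T v] bdd v by simp
  qed
  have split: "card (A \<inter> tile_edges E T) + card (tile_edges E T \<inter> ?B) = 2" if "T \<in> N" for T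
  proof -
    have "finite (tile_edges E T \<inter> incident_edges E v)" using locally_finite[OF v] by blast
    moreover have "tile_edges E T \<inter> incident_edges E v = (A \<inter> tile_edges E T) \<union> (tile_edges E T \<inter> ?B)"
      using A(1) by blast
    ultimately show ?thesis using two[OF that] by (subst card_Un_disjoint[symmetric]) auto
  qed
  have "(\<Sum>T\<in>N. card (A \<inter> tile_edges E T)) = (\<Sum>T\<in>N. \<Sum>a\<in>A. if a \<in> tile_edges E T then 1 else 0)"
    using finA by (simp add: sum.If_cases)
  also have "\<dots> = (\<Sum>a\<in>A. \<Sum>T\<in>N. if a \<in> tile_edges E T then 1 else 0)" by (rule sum.swap)
  also have "\<dots> = (\<Sum>a\<in>A. 2)"
  proof (rule sum.cong[OF refl])
    fix a assume a: "a \<in> A"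
    then have "N \<inter> {T. a \<in> tile_edges E T} = edge_tiles V E a"
      using AE edge_tiles_iff unfolding N_def by blast
    then show "(\<Sum>T\<in>N. if a \<in> tile_edges E T then 1 else (0::nat)) = 2"
      using finN a AE edge_two_tiles by (simp add: sum.If_cases subset_iff)
  qed
  finally have "even (\<Sum>T\<in>N. card (A \<inter> tile_edges E T))" by simp
  then have "even (card {T \<in> N. odd (card (A \<inter> tile_edges E T))})"
    using even_sum_iff[OF finN, of "\<lambda>T. card (A \<inter> tile_edges E T)"] by simp
  moreover have "{T \<in> N. odd (card (A \<inter> tile_edges E T))} \<noteq> {}"
  proof -
    obtain T a b where T: "T \<in> tiles V E" "a \<in> A" "b \<in> ?B" "a \<in> tile_edges E T" "b \<in> tile_edges E T"
      using link_connected[OF bdd v A] .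
    then have TN: "T \<in> N" using edge_tiles_iff AE by (auto simp: N_def)
    have "card (A \<inter> tile_edges E T) \<noteq> 0" "card (tile_edges E T \<inter> ?B) \<noteq> 0"
      using T finA locally_finite[OF v] by auto
    then have "card (A \<inter> tile_edges E T) = 1" using split[OF TN] by linarith
    then show ?thesis using TN by auto
  qed
  moreover from this finN have "0 < card {T \<in> N. odd (card (A \<inter> tile_edges E T))}"
    by (simp only: card_gt_0_iff) simp
  ultimately have "2 \<le> card {T \<in> N. odd (card (A \<inter> tile_edges E T))}"
    by (intro dvd_imp_le) simp_all
  also have "\<dots> \<le> card (SIGMA e:A. {T \<in> edge_tiles V E e. tile_edges E T \<inter> ?B \<noteq> {}})"
  proof (rule surj_card_le)
    show "finite (SIGMA e:A. {T \<in> edge_tiles V E e. tile_edges E T \<inter> ?B \<noteq> {}})"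
      using finA AE finite_edge_tiles by (intro finite_SigmaI) auto
    show "{T \<in> N. odd (card (A \<inter> tile_edges E T))} \<subseteq> snd ` (SIGMA e:A. {T \<in> edge_tiles V E e. tile_edges E T \<inter> ?B \<noteq> {}})"
    proof
      fix T assume T: "T \<in> {T \<in> N. odd (card (A \<inter> tile_edges E T))}"
      then have "card (A \<inter> tile_edges E T) + card (tile_edges E T \<inter> ?B) = 2"
        and odd: "odd (card (A \<inter> tile_edges E T))" using split[of T] by auto
      then have "card (A \<inter> tile_edges E T) \<noteq> 0" "card (tile_edges E T \<inter> ?B) \<noteq> 0"
        by presburger+
      then have "A \<inter> tile_edges E T \<noteq> {}" "tile_edges E T \<inter> ?B \<noteq> {}" by auto
      then obtain a where a: "a \<in> A" "a \<in> tile_edges E T" "tile_edges E T \<inter> ?B \<noteq> {}" by blast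
      moreover have "T \<in> tiles V E" using T by (auto simp: N_def edge_tiles_def)
      ultimately have "T \<in> edge_tiles V E a" using edge_tiles_iff AE by blast
      then show "T \<in> snd ` (SIGMA e:A. {T \<in> edge_tiles V E e. tile_edges E T \<inter> ?B \<noteq> {}})"
        using a by force
    qed
  qed
  also have "\<dots> = (\<Sum>e\<in>A. card {T \<in> edge_tiles V E e. tile_edges E T \<inter> ?B \<noteq> {}})"
    using finA AE finite_edge_tiles by (intro card_SigmaI) auto
  finally show ?thesis .
qed

end

section \<open>Charging cut edges to sides that face no full tile\<close>

context planar_graph
begin

lemma sum_cut_degrees:
  assumes "finite U" "U \<subseteq> V"
  shows "(\<Sum>v\<in>U. degree_in (cut_edges U) v) = card (cut_edges U)"
proof -
  have "card (e \<inter> U) = 1" if "e \<in> cut_edges U" for e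
  proof -
    obtain u where u: "u \<in> e" "u \<in> U" and e: "e \<in> E" "\<not> e \<inter> V \<subseteq> U"
      using \<open>e \<in> cut_edges U\<close> by (auto simp: cut_edges_def)
    then obtain y where y: "e \<inter> V = {u, y}" using edge_other_end[of e u] assms(2) by (metis subsetD)
    then have "y \<notin> U" using u(2) e(2) by auto
    moreover have "e \<inter> U = {u, y} \<inter> U" using assms(2) unfolding y[symmetric] by blast
    ultimately have "e \<inter> U = {u}" using u(2) by auto
    then show ?thesis by simp
  qed
  then show ?thesis using handshake[OF finite_inner_cut(2)[OF assms] assms(1)] by simp
qed

lemma inner_plus_cut_degree:
  assumes "finite U" "U \<subseteq> V" "v \<in> U"
  shows "degree_in (inner_edges U) v + degree_in (cut_edges U) v = degree_in E v"
proof -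
  have "incident_edges E v = incident_edges (inner_edges U) v \<union> incident_edges (cut_edges U) v"
    using assms by (auto simp: incident_edges_def inner_edges_def cut_edges_def)
  moreover have "incident_edges (inner_edges U) v \<inter> incident_edges (cut_edges U) v = {}"
    by (auto simp: incident_edges_def inner_edges_def cut_edges_def)
  moreover have "finite (incident_edges E v)" using locally_finite assms by blast
  ultimately show ?thesis unfolding degree_in_def by (metis card_Un_disjoint finite_Un)
qed

end

context tessellating_graph
begin

text \<open>Each leaf of the subgraph induced by U is charged both sides of its single edge; every other vertex
  with a cut edge is charged one side among its remaining inner edges.  Only the centre of a star
  may go unpaid, which is the role of the summand 3.\<close>

lemma cut_edges_le_corners:
  fixes M :: real
  assumes bdd: "\<And>T. T \<in> tiles V E \<Longrightarrow> bounded T"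
    and U: "finite U" "U \<subseteq> V" "U \<noteq> {}"
    and conn: "\<And>A. A \<subseteq> U \<Longrightarrow> A \<noteq> {} \<Longrightarrow> A \<noteq> U \<Longrightarrow>
      \<exists>e\<in>inner_edges U. e \<inter> A \<noteq> {} \<and> e \<inter> (U - A) \<noteq> {}"
    and M: "3 \<le> M" "\<And>v. v \<in> V \<Longrightarrow> real (degree_in E v) \<le> M"
  shows "real (card (cut_edges U)) \<le>
    (M - 2) * (real (\<Sum>e\<in>inner_edges U. card (edge_tiles V E e - full_tiles U)) + 3)"
proof -
  let ?I = "inner_edges U" and ?F = "full_tiles U"
  define d where "d v = degree_in ?I v" for v
  define b where "b v = degree_in (cut_edges U) v" for v
  define t where "t e = card (edge_tiles V E e - ?F)" for e
  define L where "L = {v \<in> U. d v = 1}"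
  define LE where "LE = {e \<in> ?I. e \<inter> L \<noteq> {}}"
  let ?r = "\<Sum>e\<in>?I. t e"
  have finI: "finite ?I" and IE: "?I \<subseteq> E"
    using finite_inner_cut(1)[OF U(1,2)] by (auto simp: inner_edges_def)
  have LEI: "LE \<subseteq> ?I" and finLE: "finite LE" using finI by (auto simp: LE_def)
  have LU: "L \<subseteq> U" by (auto simp: L_def)
  have finL: "finite L" using LU U(1) finite_subset by blast
  have ends: "e \<inter> U = e \<inter> V" if "e \<in> ?I" for e using that U(2) by (auto simp: inner_edges_def)
  have deg: "d v + b v = degree_in E v" if "v \<in> U" for v
    unfolding d_def b_def using inner_plus_cut_degree[OF U(1,2) that] .
  have cut: "card (cut_edges U) = (\<Sum>v\<in>U. b v)"
    unfolding b_def using sum_cut_degrees[OF U(1,2)] by simp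
  have nonfull: "T \<notin> ?F" if "f \<in> tile_edges E T" "f \<notin> ?I" for T f
    using that by (auto simp: full_tiles_def)
  have leaf_unique: "e = f" if "v \<in> L" "e \<in> ?I" "f \<in> ?I" "v \<in> e" "v \<in> f" for v e f
  proof -
    have "card (incident_edges ?I v) = 1" using that(1) by (simp add: L_def d_def degree_in_def)
    then obtain g where "incident_edges ?I v = {g}" by (metis card_1_singletonE)
    moreover have "e \<in> incident_edges ?I v" "f \<in> incident_edges ?I v"
      using that by (simp_all add: incident_edges_def)
    ultimately show ?thesis by simp
  qed
  \<comment> \<open>A tile containing the edge of a leaf has a second edge at that leaf, which
    cannot be inner.\<close>
  have leaf_nonfull: "T \<notin> ?F" if e: "e \<in> LE" "T \<in> edge_tiles V E e" for e T
  proof -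
    have eI: "e \<in> ?I" using e LEI by blast
    obtain v where v: "v \<in> L" "v \<in> e" using e(1) by (auto simp: LE_def)
    then have vV: "v \<in> V" using LU U(2) by blast
    have T: "T \<in> tiles V E" "e \<in> tile_edges E T" using edge_tiles_iff e(2) eI IE by blast+
    then have "card {f \<in> tile_edges E T. v \<in> f} = 2"
      using bounded_tile_cycle(3)[OF T(1) bdd[OF T(1)] vV] edge_subset_tile v by blast
    then obtain f where "f \<in> {f \<in> tile_edges E T. v \<in> f}" "f \<noteq> e" by (metis card_2_iff')
    then have f: "f \<in> tile_edges E T" "v \<in> f" "f \<noteq> e" by auto
    then have "f \<notin> ?I" using leaf_unique[OF v(1) eI _ v(2) f(2)] by blast
    then show ?thesis using nonfull f(1) by blast
  qed
  have tLE: "t e = 2" if "e \<in> LE" for e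
  proof -
    have "edge_tiles V E e - ?F = edge_tiles V E e" using leaf_nonfull[OF that] by blast
    then show ?thesis unfolding t_def using edge_two_tiles LEI IE that by auto
  qed
  have rsplit: "?r = 2 * card LE + (\<Sum>e\<in>?I - LE. t e)"
  proof -
    have "?r = (\<Sum>e\<in>LE. t e) + (\<Sum>e\<in>?I - LE. t e)"
      using sum.subset_diff[OF LEI finI, of t] by simp
    moreover have "(\<Sum>e\<in>LE. t e) = 2 * card LE" using tLE by simp
    ultimately show ?thesis by simp
  qed
  have leafb: "real (b v) \<le> M - 1" if "v \<in> L" for v
  proof -
    have "v \<in> U" "d v = 1" using that by (auto simp: L_def)
    then show ?thesis using deg[of v] M(2)[of v] U(2) by auto
  qed
  show ?thesis
  proof (cases "\<exists>z\<in>U. \<forall>e\<in>?I. z \<in> e \<longrightarrow> e \<inter> V \<subseteq> insert z L")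
    \<comment> \<open>All inner neighbours of \<open>z\<close> are leaves, so connectedness makes
      \<open>U\<close> a star around \<open>z\<close>, possibly the single vertex
      \<open>z\<close>.\<close>
    case True
    then obtain z where z: "z \<in> U" "\<And>e. e \<in> ?I \<Longrightarrow> z \<in> e \<Longrightarrow> e \<inter> V \<subseteq> insert z L" by blast
    define A where "A = insert z {w \<in> U. \<exists>e\<in>?I. z \<in> e \<and> w \<in> e}"
    have "A = U"
    proof (rule ccontr)
      assume "A \<noteq> U"
      moreover have "A \<subseteq> U" "A \<noteq> {}" using z(1) by (auto simp: A_def)
      ultimately obtain e a w where e: "e \<in> ?I" "a \<in> e" "a \<in> A" "w \<in> e" "w \<in> U - A"
        using conn[of A] by blast
      then have "z \<notin> e" by (auto simp: A_def)
      then obtain f where f: "f \<in> ?I" "z \<in> f" "a \<in> f" "a \<noteq> z" using e by (auto simp: A_def)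
      then have "a \<in> L" using z(2)[OF f(1,2)] e(3) \<open>A \<subseteq> U\<close> U(2) by blast
      then have "e = f" using leaf_unique e f by blast
      then show False using \<open>z \<notin> e\<close> f by blast
    qed
    then have "\<forall>w\<in>U - {z}. \<exists>e\<in>?I. z \<in> e \<and> w \<in> e" unfolding A_def by blast
    then obtain f where f: "\<And>w. w \<in> U - {z} \<Longrightarrow> f w \<in> ?I \<and> z \<in> f w \<and> w \<in> f w" by metis
    have leaf: "w \<in> L" if w: "w \<in> U - {z}" for w
    proof -
      have "w \<in> f w \<inter> V" using f[OF w] w U(2) by blast
      then show ?thesis using z(2)[of "f w"] f[OF w] w by blast
    qed
    have "inj_on f (U - {z})"
    proof (rule inj_onI)
      fix w w' assume w: "w \<in> U - {z}" "w' \<in> U - {z}" "f w = f w'"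
      have fE: "f w \<in> E" using f[OF w(1)] IE by blast
      obtain y where y: "f w \<inter> V = {z, y}"
        using edge_other_end[OF fE, of z] f[OF w(1)] z(1) U(2) by (metis subsetD)
      have "w \<in> f w \<inter> V" "w' \<in> f w \<inter> V" using f[OF w(1)] f[OF w(2)] w U(2) by auto
      then show "w = w'" unfolding y using w by blast
    qed
    moreover have "f ` (U - {z}) \<subseteq> LE"
      using f leaf by (auto simp: LE_def)
    ultimately have "card (U - {z}) \<le> card LE" using finLE by (rule card_inj_on_le)
    then have "2 * card (U - {z}) \<le> ?r" using rsplit by simp
    then have r: "2 * real (card (U - {z})) \<le> real ?r" by linarith
    have "real (card (cut_edges U)) = real (b z) + (\<Sum>v\<in>U - {z}. real (b v))"
      unfolding cut using U(1) z(1) by (simp add: sum.remove)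
    also have "\<dots> \<le> M + (\<Sum>v\<in>U - {z}. M - 1)"
    proof (intro add_mono sum_mono)
      show "real (b z) \<le> M" using deg[OF z(1)] M(2)[of z] z(1) U(2) by auto
    qed (use leafb leaf in blast)
    also have "\<dots> = M + real (card (U - {z})) * (M - 1)" by simp
    \<comment> \<open>Both \<open>M - 1 \<le> 2 * (M - 2)\<close>, used for the leaves, and
      \<open>M \<le> 3 * (M - 2)\<close>, used next for the centre, amount to
      \<open>3 \<le> M\<close>.\<close>
    also have "\<dots> \<le> M + real (card (U - {z})) * (2 * (M - 2))"
      using M(1) by (intro add_left_mono mult_left_mono) auto
    also have "\<dots> \<le> (M - 2) * (2 * real (card (U - {z})) + 3)"
      using M(1) by (simp add: algebra_simps)
    also have "\<dots> \<le> (M - 2) * (real ?r + 3)"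
      using M(1) r by (intro mult_left_mono) auto
    finally show ?thesis unfolding t_def .
  next
    case False
    \<comment> \<open>Now every vertex of \<open>U\<close> has an inner neighbour that is not a leaf
      besides itself. So no edge joins two leaves, and a vertex that is not a leaf has at least two
      inner edges, hence at most \<open>M - 2\<close> cut edges.\<close>
    then have nostar: "\<exists>e\<in>?I. z \<in> e \<and> \<not> e \<inter> V \<subseteq> insert z L" if "z \<in> U" for z using that by blast
    have LE1: "card (e \<inter> L) = 1" if eLE: "e \<in> LE" for e
    proof -
      have eI: "e \<in> ?I" using eLE LEI by blast
      obtain v where v: "v \<in> e" "v \<in> L" using eLE by (auto simp: LE_def)
      obtain f where f: "f \<in> ?I" "v \<in> f" "\<not> f \<inter> V \<subseteq> insert v L" using nostar[of v] v(2) LU by auto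
      then have "f = e" using leaf_unique[OF v(2) f(1) eI f(2) v(1)] by simp
      moreover obtain y where "e \<inter> V = {v, y}"
        using edge_other_end[of e v] eI IE v LU U(2) by (metis subsetD)
      ultimately have "y \<notin> L" "e \<inter> V = {v, y}" using f(3) by auto
      moreover have "e \<inter> L = e \<inter> V \<inter> L" using LU U(2) by blast
      ultimately have "e \<inter> L = {v}" using v(2) by simp
      then show ?thesis by simp
    qed
    have "card L = (\<Sum>v\<in>L. degree_in LE v)"
    proof -
      have "degree_in LE v = 1" if "v \<in> L" for v
      proof -
        have "incident_edges LE v = incident_edges ?I v"
          using that by (auto simp: incident_edges_def LE_def)
        then show ?thesis using that by (simp add: degree_in_def L_def d_def)
      qed
      then show ?thesis by simp
    qed
    also have "\<dots> = card LE" using handshake[OF finLE finL] LE1 by simp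
    finally have cardL: "card L = card LE" .
    define B where "B = {v \<in> U - L. b v > 0}"
    have finB: "finite B" using U(1) by (simp add: B_def)
    \<comment> \<open>The inner edges at \<open>v\<close> that do not end in a leaf are separated
      from its cut edges and leaf edges. A tile with edges of both kinds is not full: a cut edge is
      not inner, and an edge at a leaf has no full tile.\<close>
    have atB: "2 \<le> (\<Sum>e\<in>{e \<in> ?I - LE. v \<in> e}. t e)" if v: "v \<in> B" for v
    proof -
      let ?A = "{e \<in> ?I - LE. v \<in> e}" and ?C = "incident_edges E v - {e \<in> ?I - LE. v \<in> e}"
      have vU: "v \<in> U" "v \<notin> L" and vV: "v \<in> V" using v U(2) by (auto simp: B_def)
      obtain e where e: "e \<in> ?I" "v \<in> e" "\<not> e \<inter> V \<subseteq> insert v L" using nostar[OF vU(1)] by blast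
      have eE: "e \<in> E" using e(1) IE by blast
      obtain y where y: "e \<inter> V = {v, y}" using edge_other_end[OF eE e(2) vV] by metis
      then have "y \<notin> L" using e(3) by auto
      moreover have "e \<inter> L = e \<inter> V \<inter> L" using LU U(2) by blast
      ultimately have "e \<inter> L = {}" using y vU(2) by simp
      then have "?A \<noteq> {}" using e by (auto simp: LE_def)
      moreover have "?C \<noteq> {}"
      proof -
        have "incident_edges (cut_edges U) v \<noteq> {}" using v by (auto simp: B_def b_def degree_in_def)
        then show ?thesis by (auto simp: incident_edges_def cut_edges_def inner_edges_def)
      qed
      moreover have "?A \<subseteq> incident_edges E v" using IE by (auto simp: incident_edges_def)
      ultimately have "2 \<le> (\<Sum>e\<in>?A. card {T \<in> edge_tiles V E e. tile_edges E T \<inter> ?C \<noteq> {}})"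
        by (intro link_two_tiles[OF bdd vV])
      also have "\<dots> \<le> (\<Sum>e\<in>?A. t e)"
      proof (rule sum_mono)
        fix e assume e: "e \<in> ?A"
        then have eE: "e \<in> E" using IE by blast
        have "{T \<in> edge_tiles V E e. tile_edges E T \<inter> ?C \<noteq> {}} \<subseteq> edge_tiles V E e - ?F"
        proof
          fix T assume "T \<in> {T \<in> edge_tiles V E e. tile_edges E T \<inter> ?C \<noteq> {}}"
          then obtain f where T: "T \<in> edge_tiles V E e" and f: "f \<in> tile_edges E T" "f \<in> ?C" by blast
          have "T \<notin> ?F"
          proof (cases "f \<in> ?I")
            case True
            then have "f \<in> LE" "f \<in> E" using f(2) IE by (auto simp: incident_edges_def)
            moreover have "T \<in> edge_tiles V E f"
              using edge_tiles_iff[OF \<open>f \<in> E\<close>] f(1) T by (simp add: edge_tiles_def)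
            ultimately show ?thesis using leaf_nonfull by blast
          qed (use nonfull f in blast)
          then show "T \<in> edge_tiles V E e - ?F" using T by blast
        qed
        then show "card {T \<in> edge_tiles V E e. tile_edges E T \<inter> ?C \<noteq> {}} \<le> t e"
          unfolding t_def using finite_edge_tiles[OF eE] by (intro card_mono) auto
      qed
      finally show ?thesis .
    qed
    \<comment> \<open>A side is claimed at most by the two ends of its edge, so two claims per
      vertex of \<open>B\<close> pay for one side each.\<close>
    have "2 * card B = (\<Sum>v\<in>B. 2)" by simp
    also have "\<dots> \<le> (\<Sum>v\<in>B. \<Sum>e\<in>{e \<in> ?I - LE. v \<in> e}. t e)" by (rule sum_mono) (rule atB)
    also have "\<dots> \<le> (\<Sum>v\<in>U. \<Sum>e\<in>{e \<in> ?I - LE. v \<in> e}. t e)"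
      by (rule sum_mono2) (use U(1) B_def in auto)
    also have "\<dots> = (\<Sum>e\<in>?I - LE. \<Sum>v\<in>{v \<in> U. v \<in> e}. t e)"
      using finI U(1) by (intro sum.swap_restrict) auto
    also have "\<dots> = (\<Sum>e\<in>?I - LE. 2 * t e)"
    proof (rule sum.cong[OF refl])
      fix e assume e: "e \<in> ?I - LE"
      then have "{v \<in> U. v \<in> e} = e \<inter> V" using ends[of e] by blast
      then show "(\<Sum>v\<in>{v \<in> U. v \<in> e}. t e) = 2 * t e" using card_ends[of e] e IE by auto
    qed
    also have "\<dots> = 2 * (\<Sum>e\<in>?I - LE. t e)" by (simp add: sum_distrib_left)
    finally have "2 * card L + card B \<le> ?r" using rsplit cardL by simp
    then have r: "2 * real (card L) + real (card B) \<le> real ?r" by linarith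
    have "card (cut_edges U) = (\<Sum>v\<in>L \<union> B. b v)"
      unfolding cut using U(1) LU by (intro sum.mono_neutral_right) (auto simp: B_def)
    also have "\<dots> = (\<Sum>v\<in>L. b v) + (\<Sum>v\<in>B. b v)"
      using finL finB by (intro sum.union_disjoint) (auto simp: B_def)
    finally have "real (card (cut_edges U)) = (\<Sum>v\<in>L. real (b v)) + (\<Sum>v\<in>B. real (b v))" by simp
    also have "\<dots> \<le> (\<Sum>v\<in>L. M - 1) + (\<Sum>v\<in>B. M - 2)"
    proof (intro add_mono sum_mono)
      show "real (b v) \<le> M - 1" if "v \<in> L" for v using leafb[OF that] .
      show "real (b v) \<le> M - 2" if v: "v \<in> B" for v
      proof -
        have vU: "v \<in> U" "v \<notin> L" "v \<in> V" using v U(2) by (auto simp: B_def)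
        obtain e where "e \<in> incident_edges ?I v" using nostar[OF vU(1)] by (auto simp: incident_edges_def)
        moreover have "finite (incident_edges ?I v)" using finI by (simp add: incident_edges_def)
        ultimately have "d v \<noteq> 0" by (auto simp: d_def degree_in_def)
        then have "d v \<ge> 2" using vU by (cases "d v = 1") (auto simp: L_def)
        then show ?thesis using deg[OF vU(1)] M(2)[OF vU(3)] by linarith
      qed
    qed
    also have "\<dots> = real (card L) * (M - 1) + real (card B) * (M - 2)" by simp
    also have "\<dots> \<le> real (card L) * (2 * (M - 2)) + real (card B) * (M - 2)"
      using M(1) by (intro add_right_mono mult_left_mono) auto
    also have "\<dots> = (M - 2) * (2 * real (card L) + real (card B))" by (simp add: algebra_simps)
    also have "\<dots> \<le> (M - 2) * (real ?r + 3)" using M(1) r by (intro mult_left_mono) auto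
    finally show ?thesis unfolding t_def .
  qed
qed

end

section \<open>Real versions of the metric quantities and bounds from M and P\<close>

lemma INF_ereal_attained:
  fixes f :: "'a \<Rightarrow> real"
  assumes "finite I" "I \<noteq> {}"
  obtains a where "a \<in> I" "\<And>b. b \<in> I \<Longrightarrow> f a \<le> f b" "(INF b\<in>I. ereal (f b)) = ereal (f a)"
proof -
  obtain a where a: "a \<in> I" "\<And>b. b \<in> I \<Longrightarrow> f a \<le> f b"
    using assms ex_min_if_finite[of "f ` I"] by (metis (no_types, lifting) arg_min_if_finite(1) arg_min_least)
  then have "(INF b\<in>I. ereal (f b)) = ereal (f a)"
    by (intro antisym INF_lower INF_greatest) auto
  then show thesis using that a by blast
qed

context tessellating_metric_graph
begin

text \<open>Building the value 0 for unbounded tiles into the reciprocal keeps all characteristic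
  values real.\<close>

definition inv_perimeter :: "complex set \<Rightarrow> real" where
  "inv_perimeter T = (if bounded T then 1 / (\<Sum>e\<in>tile_edges E T. len e) else 0)"

definition char_real :: "complex set \<Rightarrow> real" where
  "char_real e = 1 / len e - (\<Sum>v\<in>e \<inter> V. 1 / vertex_weight E len v)
     - (\<Sum>T\<in>edge_tiles V E e. inv_perimeter T)"

lemma sum_len_pos: "finite I \<Longrightarrow> I \<noteq> {} \<Longrightarrow> I \<subseteq> E \<Longrightarrow> 0 < (\<Sum>e\<in>I. len e)"
  using len_pos by (intro sum_pos) auto

lemma vertex_weight_pos: "v \<in> V \<Longrightarrow> 0 < vertex_weight E len v"
  unfolding vertex_weight_def using locally_finite[of v] vertex_edge[of v]
  by (intro sum_len_pos) (auto simp: incident_edges_def)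

lemma perimeter_pos: "T \<in> tiles V E \<Longrightarrow> bounded T \<Longrightarrow> 0 < (\<Sum>e\<in>tile_edges E T. len e)"
  using bounded_tile_cycle(1,2)[of T] tile_edges_subset by (intro sum_len_pos) auto

lemma inv_perimeter_nonneg: "T \<in> tiles V E \<Longrightarrow> 0 \<le> inv_perimeter T"
  using perimeter_pos by (simp add: inv_perimeter_def less_imp_le)

lemma inverse_perimeter: "T \<in> tiles V E \<Longrightarrow> 1 / perimeter E len T = ereal (inv_perimeter T)"
  using perimeter_pos[of T] by (auto simp: perimeter_def inv_perimeter_def one_ereal_def)

lemma char_value_real: "char_value V E len e = ereal (char_real e)"
proof -
  have "(\<Sum>T\<in>edge_tiles V E e. 1 / perimeter E len T) = (\<Sum>T\<in>edge_tiles V E e. ereal (inv_perimeter T))"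
    by (intro sum.cong refl inverse_perimeter) (auto simp: edge_tiles_def)
  then show ?thesis by (simp add: char_value_def char_real_def)
qed

lemma obtain_edge: obtains e where "e \<in> E"
  using infinite_vertices vertex_edge by (metis finite.emptyI subsetI finite_subset)

lemma c_star_real:
  assumes "c_star V E len > 0"
  obtains c where "c > 0" "c_star V E len = ereal c" "\<And>e. e \<in> E \<Longrightarrow> c \<le> char_real e"
proof -
  obtain e where e: "e \<in> E" by (rule obtain_edge)
  have le: "c_star V E len \<le> ereal (char_real e)" if "e \<in> E" for e
    unfolding c_star_def char_value_real using that by (rule INF_lower)
  then obtain c where c: "c_star V E len = ereal c"
    using assms e by (cases "c_star V E len") force+
  then show thesis using that[of c] assms le by simp
qed

text \<open>The infimum over the finitely many edges at \<open>v\<close> is attained, hence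
  positive. The weight is at least the degree times the shortest length, which turns M into a bound
  for the degrees.\<close>

lemma M_const_bounds:
  assumes "v \<in> V"
  shows "e \<in> incident_edges E v \<Longrightarrow> ereal (vertex_weight E len v / len e) \<le> M_const V E len"
    and "ereal (real (degree_in E v)) \<le> M_const V E len"
proof -
  let ?I = "incident_edges E v"
  obtain g where "g \<in> E" "v \<in> g" using vertex_edge[OF assms] .
  then have I: "finite ?I" "?I \<noteq> {}" "?I \<subseteq> E"
    using locally_finite[OF assms] by (auto simp: incident_edges_def)
  obtain a where a: "a \<in> ?I" "\<And>b. b \<in> ?I \<Longrightarrow> len a \<le> len b" "(INF b\<in>?I. ereal (len b)) = ereal (len a)"
    using INF_ereal_attained[OF I(1,2)] by metis
  have la: "len a > 0" using a(1) I(3) len_pos by blast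
  have "ereal (vertex_weight E len v) / (INF e\<in>?I. ereal (len e)) \<le> M_const V E len"
    unfolding M_const_def using assms by (rule SUP_upper)
  then have M: "ereal (vertex_weight E len v / len a) \<le> M_const V E len" unfolding a(3) using la by simp
  show "ereal (vertex_weight E len v / len e) \<le> M_const V E len" if "e \<in> ?I"
  proof -
    have "vertex_weight E len v / len e \<le> vertex_weight E len v / len a"
      using a(2)[OF that] la vertex_weight_pos[OF assms] by (intro divide_left_mono) auto
    then show ?thesis using M by (meson ereal_less_eq(3) order_trans)
  qed
  have "real (card ?I) * len a \<le> vertex_weight E len v"
    unfolding vertex_weight_def using a(2) by (intro sum_bounded_below) auto
  then have "real (degree_in E v) \<le> vertex_weight E len v / len a"
    using la by (simp add: degree_in_def pos_le_divide_eq)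
  then show "ereal (real (degree_in E v)) \<le> M_const V E len" using M by (meson ereal_less_eq(3) order_trans)
qed

text \<open>For a bounded tile the shortest edge attains the infimum, and the perimeter consists of
  at least three edges; this is the source of \<open>3 \<le> P\<close>.\<close>

lemma P_const_bounds:
  assumes T: "T \<in> tiles V E"
  shows "bounded T \<Longrightarrow> e \<in> tile_edges E T \<Longrightarrow> ereal ((\<Sum>f\<in>tile_edges E T. len f) / len e) \<le> P_const V E len"
    and "\<not> bounded T \<Longrightarrow> P_const V E len = \<infinity>"
    and "3 \<le> P_const V E len"
proof -
  let ?I = "tile_edges E T"
  have ub: "perimeter E len T / (INF e\<in>?I. ereal (len e)) \<le> P_const V E len"
    unfolding P_const_def using T by (rule SUP_upper)
  have bd: "3 \<le> P_const V E len \<and> (\<forall>e\<in>?I. ereal ((\<Sum>f\<in>?I. len f) / len e) \<le> P_const V E len)" if B: "bounded T"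
  proof -
    have I: "finite ?I" "3 \<le> card ?I" "?I \<subseteq> E"
      using bounded_tile_cycle(1,2)[OF T B] tile_edges_subset by auto
    then have "?I \<noteq> {}" by auto
    then obtain a where a: "a \<in> ?I" "\<And>b. b \<in> ?I \<Longrightarrow> len a \<le> len b" "(INF b\<in>?I. ereal (len b)) = ereal (len a)"
      using INF_ereal_attained[OF I(1)] by metis
    have la: "len a > 0" using a(1) I(3) len_pos by blast
    have P: "ereal ((\<Sum>f\<in>?I. len f) / len a) \<le> P_const V E len"
      using ub unfolding a(3) perimeter_def using B la by simp
    have "(\<Sum>f\<in>?I. len f) / len e \<le> (\<Sum>f\<in>?I. len f) / len a" if "e \<in> ?I" for e
      using a(2)[OF that] la perimeter_pos[OF T B] by (intro divide_left_mono) auto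
    then have "\<forall>e\<in>?I. ereal ((\<Sum>f\<in>?I. len f) / len e) \<le> P_const V E len"
      using P by (meson ereal_less_eq(3) order_trans)
    moreover have "3 \<le> (\<Sum>f\<in>?I. len f) / len a"
    proof -
      have "3 * len a \<le> real (card ?I) * len a" using I(2) la by (intro mult_right_mono) auto
      also have "\<dots> \<le> (\<Sum>f\<in>?I. len f)" using a(2) by (intro sum_bounded_below) auto
      finally show ?thesis using la by (simp add: pos_le_divide_eq)
    qed
    then have "3 \<le> P_const V E len" using P by (metis ereal_less_eq(3) numeral_eq_ereal order_trans)
    ultimately show ?thesis by blast
  qed
  then show "bounded T \<Longrightarrow> e \<in> ?I \<Longrightarrow> ereal ((\<Sum>f\<in>?I. len f) / len e) \<le> P_const V E len" by blast
  show inf: "P_const V E len = \<infinity>" if "\<not> bounded T"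
  proof -
    have "is_infinite_chain V E (frontier T)" using unbounded_tile[OF T that] by blast
    then obtain d :: "int \<Rightarrow> complex set" where "\<And>i. d i \<in> E" "frontier T = (\<Union>i. d i)"
      unfolding is_infinite_chain_def by auto
    then have e: "d 0 \<in> ?I" by (auto simp: tile_edges_def)
    let ?l = "INF e\<in>?I. ereal (len e)"
    have "?l \<le> ereal (len (d 0))" using e by (rule INF_lower)
    moreover have "0 \<le> ?l" using len_pos tile_edges_subset by (intro INF_greatest) (auto simp: less_imp_le subset_iff)
    \<comment> \<open>Over infinitely many edges the infimum may be 0, where the quotient is still
      infinite. The edge \<open>d 0\<close> is needed to keep \<open>?l\<close> finite, since
      \<infinity> divided by \<infinity> would be 0.\<close>
    ultimately have "(\<infinity>::ereal) / ?l = \<infinity>"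
      by (cases ?l) (auto simp: divide_ereal_def zero_ereal_def)
    then show ?thesis using ub that by (simp add: perimeter_def)
  qed
  then show "3 \<le> P_const V E len" using bd by (cases "bounded T") auto
qed

text \<open>The constants \<open>1 / M\<close> and \<open>1 / P\<close> are used instead of M and P, so that infinite M or P become 0.\<close>

lemma reciprocal_constants:
  obtains \<mu> \<pi> \<kappa> :: real where
    "0 \<le> \<mu>" "0 \<le> \<pi>"
    "\<And>v e. v \<in> V \<Longrightarrow> e \<in> incident_edges E v \<Longrightarrow> \<mu> \<le> len e / vertex_weight E len v"
    "\<And>T e. T \<in> tiles V E \<Longrightarrow> e \<in> tile_edges E T \<Longrightarrow> \<pi> \<le> len e * inv_perimeter T"
    "\<And>T. 0 < \<pi> \<Longrightarrow> T \<in> tiles V E \<Longrightarrow> bounded T"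
    "\<And>v. 0 < \<mu> \<Longrightarrow> v \<in> V \<Longrightarrow> real (degree_in E v) \<le> 1 / \<mu>"
    "\<mu> \<le> 1 / 3" "\<pi> \<le> 1 / 3"
    "\<kappa> = (if \<mu> = 0 \<or> \<pi> = 0 then 0 else 1 / ((1 / \<mu> - 2) * (1 / \<pi>)))"
    "K_const V E len = ereal (1 - \<mu> - 2 * \<pi> - \<kappa>)"
proof -
  let ?M = "M_const V E len" and ?P = "P_const V E len"
  obtain e where e: "e \<in> E" by (rule obtain_edge)
  obtain v where v: "v \<in> V" "v \<in> e" using ends_nonempty e by blast
  obtain T where "T \<in> edge_tiles V E e" using edge_two_tiles[OF e] by (metis card_2_iff')
  then have T: "T \<in> tiles V E" by (simp add: edge_tiles_def)
  have "ereal 3 \<le> ?M"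
    using M_const_bounds(2)[OF v(1)] degree_ge_3[OF v(1)]
    by (metis ereal_less_eq(3) of_nat_le_iff of_nat_numeral order_trans)
  then consider m where "?M = ereal m" "3 \<le> m" | "?M = \<infinity>" by (cases ?M) auto
  note M = this
  have "ereal 3 \<le> ?P" using P_const_bounds(3)[OF T] by simp
  then consider p where "?P = ereal p" "3 \<le> p" | "?P = \<infinity>"
    by (cases ?P) auto
  note P = this
  define \<mu> where "\<mu> = (if ?M = \<infinity> then 0 else 1 / real_of_ereal ?M)"
  define \<pi> where "\<pi> = (if ?P = \<infinity> then 0 else 1 / real_of_ereal ?P)"
  \<comment> \<open>The last term of K. The case distinction matters: for \<open>\<mu> = 0\<close>
    the default \<open>1 / 0 = 0\<close> would turn the formula into \<open>- \<pi> / 2\<close>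
    instead of the correct value 0.\<close>
  define \<kappa> where "\<kappa> = (if \<mu> = 0 \<or> \<pi> = 0 then 0 else 1 / ((1 / \<mu> - 2) * (1 / \<pi>)))"
  have 1: "\<mu> \<le> len f / vertex_weight E len w" if w: "w \<in> V" "f \<in> incident_edges E w" for w f
  proof -
    have pos: "0 < len f" "0 < vertex_weight E len w"
      using w len_pos vertex_weight_pos by (auto simp: incident_edges_def)
    from M show ?thesis
    proof cases
      case (1 m)
      then have "vertex_weight E len w / len f \<le> m" using M_const_bounds(1)[OF w] by simp
      then show ?thesis using pos 1 by (simp add: \<mu>_def field_simps)
    next
      case 2
      then show ?thesis using pos by (simp add: \<mu>_def)
    qed
  qed
  have 2: "\<pi> \<le> len f * inv_perimeter S" if S: "S \<in> tiles V E" "f \<in> tile_edges E S" for S f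
  proof -
    have f: "0 < len f" using S(2) len_pos tile_edges_subset by blast
    from P show ?thesis
    proof cases
      case (1 p)
      then have B: "bounded S" using P_const_bounds(2)[OF S(1)] by auto
      then have "(\<Sum>f\<in>tile_edges E S. len f) / len f \<le> p" using P_const_bounds(1)[OF S(1) B S(2)] 1 by simp
      then show ?thesis using f 1 B perimeter_pos[OF S(1) B] by (simp add: \<pi>_def inv_perimeter_def field_simps)
    next
      case 2
      then show ?thesis using f inv_perimeter_nonneg[OF S(1)] by (simp add: \<pi>_def)
    qed
  qed
  have 3: "bounded S" if "0 < \<pi>" "S \<in> tiles V E" for S
    using P_const_bounds(2)[OF that(2)] that(1) by (auto simp: \<pi>_def split: if_splits)
  have 4: "real (degree_in E w) \<le> 1 / \<mu>" if "0 < \<mu>" "w \<in> V" for w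
    using M M_const_bounds(2)[OF that(2)] that(1) by cases (auto simp: \<mu>_def)
  have 5: "0 \<le> \<mu>" "\<mu> \<le> 1 / 3" using M by (cases; auto simp: \<mu>_def field_simps)+
  have 6: "0 \<le> \<pi>" "\<pi> \<le> 1 / 3" using P by (cases; auto simp: \<pi>_def field_simps)+
  have "K_const V E len = ereal (1 - \<mu> - 2 * \<pi> - \<kappa>)"
  proof -
    have one: "1 / ?M = ereal \<mu>" using M by cases (auto simp: \<mu>_def one_ereal_def)
    have two: "2 / ?P = ereal (2 * \<pi>)" using P
    proof cases
      case (1 p)
      then show ?thesis using ereal_divide[of 2 p] by (simp add: \<pi>_def)
    qed (simp add: \<pi>_def)
    have three: "1 / ((?M - 2) * ?P) = ereal \<kappa>"
      using M
    proof cases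
      case (1 m)
      note m = this
      have M2: "?M - 2 = ereal (m - 2)" unfolding m(1) by (metis ereal_minus(1) numeral_eq_ereal)
      from P show ?thesis
      proof cases
        case (1 p)
        have "1 / ((?M - 2) * ?P) = ereal (1 / ((m - 2) * p))"
          unfolding M2 1(1) using m 1 by (simp add: one_ereal_def)
        then show ?thesis using m 1 by (simp add: \<kappa>_def \<mu>_def \<pi>_def)
      next
        case 2
        have "1 / ((?M - 2) * ?P) = 0" unfolding M2 2 using m by simp
        then show ?thesis using 2 by (simp add: \<kappa>_def \<pi>_def)
      qed
    next
      case 2
      have M2: "?M - 2 = \<infinity>" unfolding 2 by simp
      have "(\<infinity>::ereal) * ?P = \<infinity>" using P by cases auto
      then have "1 / ((?M - 2) * ?P) = 0" unfolding M2 by simp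
      then show ?thesis using 2 by (simp add: \<kappa>_def \<mu>_def)
    qed
    show ?thesis unfolding K_const_def Let_def one two three by (simp add: one_ereal_def)
  qed
  then show thesis using that[of \<mu> \<pi> \<kappa>] 1 2 3 4 5 6 \<kappa>_def by blast
qed


section \<open>Summing characteristic values over the edges meeting a vertex set\<close>

text \<open>Beyond the contributions 1, the remaining terms are bounded one by one: the end of a cut
  edge outside \<open>U\<close> gives at least \<open>\<mu>\<close>, and a side facing no full tile
  at least \<open>\<pi>\<close>. Both sides of a cut edge are of this kind, because full tiles have
  inner edges only.\<close>

lemma star_sum_estimate:
  fixes \<mu> \<pi> :: real
  assumes U: "finite U" "U \<subseteq> V"
    and \<mu>: "0 \<le> \<mu>" "\<And>v e. v \<in> V \<Longrightarrow> e \<in> incident_edges E v \<Longrightarrow> \<mu> \<le> len e / vertex_weight E len v"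
    and \<pi>: "0 \<le> \<pi>" "\<And>T e. T \<in> tiles V E \<Longrightarrow> e \<in> tile_edges E T \<Longrightarrow> \<pi> \<le> len e * inv_perimeter T"
  shows "(\<Sum>e\<in>inner_edges U \<union> cut_edges U. len e * char_real e) \<le>
    real (card (inner_edges U)) + real (card (cut_edges U))
    - (real (card U) + \<mu> * real (card (cut_edges U)))
    - (real (card (full_tiles U)) + \<pi> * (2 * real (card (cut_edges U))
        + real (\<Sum>e\<in>inner_edges U. card (edge_tiles V E e - full_tiles U))))"
proof -
  let ?I = "inner_edges U" and ?C = "cut_edges U" and ?F = "full_tiles U"
  let ?W = "?I \<union> ?C"
  let ?m = "vertex_weight E len"
  have W: "?W = {e \<in> E. e \<inter> U \<noteq> {}}" and disj: "?I \<inter> ?C = {}" using inner_cut_edges U(2) by auto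
  have fin: "finite ?I" "finite ?C" "finite ?W" using finite_inner_cut[OF U] by auto
  have finF: "finite ?F" by (rule finite_full_tiles[OF U])
  have WE: "?W \<subseteq> E" using W by auto
  have vertices: "real (card U) + \<mu> * real (card ?C) \<le> (\<Sum>e\<in>?W. \<Sum>v\<in>e \<inter> V. len e / ?m v)"
  proof -
    have "real (card U) = (\<Sum>v\<in>U. \<Sum>e\<in>{e \<in> ?W. v \<in> e}. len e / ?m v)"
    proof -
      have "(\<Sum>e\<in>{e \<in> ?W. v \<in> e}. len e / ?m v) = 1" if v: "v \<in> U" for v
      proof -
        have "{e \<in> ?W. v \<in> e} = incident_edges E v" unfolding W using v by (auto simp: incident_edges_def)
        then have "(\<Sum>e\<in>{e \<in> ?W. v \<in> e}. len e / ?m v) = ?m v / ?m v"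
          by (simp only: sum_divide_distrib vertex_weight_def)
        then show ?thesis using vertex_weight_pos[of v] v U(2) by auto
      qed
      then show ?thesis by simp
    qed
    also have "\<dots> = (\<Sum>e\<in>?W. \<Sum>v\<in>{v \<in> U. v \<in> e}. len e / ?m v)"
      using U(1) fin(3) by (rule sum.swap_restrict)
    finally have 1: "real (card U) = (\<Sum>e\<in>?W. \<Sum>v\<in>{v \<in> U. v \<in> e}. len e / ?m v)" .
    have "(\<Sum>e\<in>?W. if e \<in> ?C then \<mu> else 0) = (\<Sum>e\<in>?C. \<mu>)"
      using fin(3) by (intro sum.mono_neutral_cong_right) auto
    then have 2: "\<mu> * real (card ?C) = (\<Sum>e\<in>?W. if e \<in> ?C then \<mu> else 0)" by simp
    have "(\<Sum>v\<in>{v \<in> U. v \<in> e}. len e / ?m v) + (if e \<in> ?C then \<mu> else 0)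
        \<le> (\<Sum>v\<in>e \<inter> V. len e / ?m v)" if e: "e \<in> ?W" for e
    proof -
      have eE: "e \<in> E" using e WE by blast
      have nonneg: "0 \<le> len e / ?m v" if "v \<in> V" for v
        using len_pos[OF eE] vertex_weight_pos[OF that] by simp
      have "{v \<in> U. v \<in> e} \<subseteq> e \<inter> V" using U(2) by blast
      then have "(\<Sum>v\<in>e \<inter> V. len e / ?m v) = (\<Sum>v\<in>e \<inter> V - {v \<in> U. v \<in> e}. len e / ?m v)
          + (\<Sum>v\<in>{v \<in> U. v \<in> e}. len e / ?m v)"
        using finite_ends[OF eE] by (rule sum.subset_diff)
      moreover have "(if e \<in> ?C then \<mu> else 0) \<le> (\<Sum>v\<in>e \<inter> V - {v \<in> U. v \<in> e}. len e / ?m v)"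
      proof (cases "e \<in> ?C")
        case True
        then obtain w where w: "w \<in> e" "w \<in> V" "w \<notin> U" by (auto simp: cut_edges_def)
        have "\<mu> \<le> len e / ?m w" using \<mu>(2)[OF w(2)] w(1) eE by (simp add: incident_edges_def)
        also have "\<dots> \<le> (\<Sum>v\<in>e \<inter> V - {v \<in> U. v \<in> e}. len e / ?m v)"
          using w finite_ends[OF eE] nonneg by (intro member_le_sum) auto
        finally show ?thesis using True by simp
      next
        case False
        have "0 \<le> (\<Sum>v\<in>e \<inter> V - {v \<in> U. v \<in> e}. len e / ?m v)"
          using nonneg by (intro sum_nonneg) auto
        then show ?thesis using False by simp
      qed
      ultimately show ?thesis by simp
    qed
    then show ?thesis unfolding 1 2 sum.distrib[symmetric] by (rule sum_mono)
  qed
  have tiles: "real (card ?F) + \<pi> * (2 * real (card ?C) + real (\<Sum>e\<in>?I. card (edge_tiles V E e - ?F)))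
      \<le> (\<Sum>e\<in>?W. \<Sum>T\<in>edge_tiles V E e. len e * inv_perimeter T)"
  proof -
    have "real (card ?F) = (\<Sum>T\<in>?F. \<Sum>e\<in>{e \<in> ?W. T \<in> edge_tiles V E e}. len e * inv_perimeter T)"
    proof -
      have "(\<Sum>e\<in>{e \<in> ?W. T \<in> edge_tiles V E e}. len e * inv_perimeter T) = 1" if "T \<in> ?F" for T
      proof -
        have T: "T \<in> tiles V E" "bounded T" "tile_edges E T \<subseteq> ?I"
          using that by (auto simp: full_tiles_def)
        have "{e \<in> ?W. T \<in> edge_tiles V E e} = tile_edges E T"
          using T(1,3) WE edge_tiles_iff tile_edges_subset by blast
        then have "(\<Sum>e\<in>{e \<in> ?W. T \<in> edge_tiles V E e}. len e * inv_perimeter T)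
            = (\<Sum>e\<in>tile_edges E T. len e) * inv_perimeter T"
          by (simp add: sum_distrib_right)
        then show ?thesis using perimeter_pos[OF T(1,2)] T(2) by (simp add: inv_perimeter_def)
      qed
      then show ?thesis by simp
    qed
    also have "\<dots> = (\<Sum>e\<in>?W. \<Sum>T\<in>{T \<in> ?F. T \<in> edge_tiles V E e}. len e * inv_perimeter T)"
      using finF fin(3) by (rule sum.swap_restrict)
    finally have 1: "real (card ?F) = (\<Sum>e\<in>?W. \<Sum>T\<in>{T \<in> ?F. T \<in> edge_tiles V E e}. len e * inv_perimeter T)" .
    have cut2: "card (edge_tiles V E e - ?F) = 2" if e: "e \<in> ?C" for e
    proof -
      have eE: "e \<in> E" "e \<notin> ?I" using e disj WE by blast+
      then have "edge_tiles V E e - ?F = edge_tiles V E e"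
        using edge_tiles_iff[OF eE(1)] by (auto simp: full_tiles_def)
      then show ?thesis using edge_two_tiles[OF eE(1)] by simp
    qed
    have "real (\<Sum>e\<in>?W. card (edge_tiles V E e - ?F))
        = 2 * real (card ?C) + real (\<Sum>e\<in>?I. card (edge_tiles V E e - ?F))"
      using sum.union_disjoint[OF fin(1,2) disj, of "\<lambda>e. card (edge_tiles V E e - ?F)"] cut2 by simp
    then have 2: "\<pi> * (2 * real (card ?C) + real (\<Sum>e\<in>?I. card (edge_tiles V E e - ?F)))
        = (\<Sum>e\<in>?W. \<pi> * real (card (edge_tiles V E e - ?F)))"
      by (simp flip: sum_distrib_left)
    have "(\<Sum>T\<in>{T \<in> ?F. T \<in> edge_tiles V E e}. len e * inv_perimeter T)
        + \<pi> * real (card (edge_tiles V E e - ?F))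
        \<le> (\<Sum>T\<in>edge_tiles V E e. len e * inv_perimeter T)" if e: "e \<in> ?W" for e
    proof -
      have eE: "e \<in> E" using e WE by blast
      have "{T \<in> ?F. T \<in> edge_tiles V E e} \<subseteq> edge_tiles V E e" by blast
      then have "(\<Sum>T\<in>edge_tiles V E e. len e * inv_perimeter T)
          = (\<Sum>T\<in>edge_tiles V E e - {T \<in> ?F. T \<in> edge_tiles V E e}. len e * inv_perimeter T)
            + (\<Sum>T\<in>{T \<in> ?F. T \<in> edge_tiles V E e}. len e * inv_perimeter T)"
        using finite_edge_tiles[OF eE] by (rule sum.subset_diff)
      moreover have "edge_tiles V E e - {T \<in> ?F. T \<in> edge_tiles V E e} = edge_tiles V E e - ?F" by blast
      moreover have "real (card (edge_tiles V E e - ?F)) * \<pi>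
          \<le> (\<Sum>T\<in>edge_tiles V E e - ?F. len e * inv_perimeter T)"
        using \<pi>(2) edge_tiles_iff[OF eE] by (intro sum_bounded_below) blast
      ultimately show ?thesis by (simp add: mult.commute)
    qed
    then show ?thesis unfolding 1 2 sum.distrib[symmetric] by (rule sum_mono)
  qed
  have "len e * char_real e = 1 - (\<Sum>v\<in>e \<inter> V. len e / ?m v)
      - (\<Sum>T\<in>edge_tiles V E e. len e * inv_perimeter T)" if "e \<in> ?W" for e
    using len_pos[of e] that WE
    by (auto simp: char_real_def right_diff_distrib sum_distrib_left)
  then have "(\<Sum>e\<in>?W. len e * char_real e) = real (card ?W) - (\<Sum>e\<in>?W. \<Sum>v\<in>e \<inter> V. len e / ?m v)
      - (\<Sum>e\<in>?W. \<Sum>T\<in>edge_tiles V E e. len e * inv_perimeter T)"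
    by (simp add: sum_subtractf)
  moreover have "card ?W = card ?I + card ?C" using fin disj by (intro card_Un_disjoint)
  ultimately show ?thesis using vertices tiles by simp
qed

text \<open>Each end costs at least \<open>\<mu>\<close> and each side at least
  \<open>\<pi>\<close>. This bound for a single edge later yields the positivity of K and deals with
  the edges between two boundary vertices.\<close>

lemma char_real_le:
  fixes \<mu> \<pi> :: real
  assumes "\<And>v e. v \<in> V \<Longrightarrow> e \<in> incident_edges E v \<Longrightarrow> \<mu> \<le> len e / vertex_weight E len v"
    and "\<And>T e. T \<in> tiles V E \<Longrightarrow> e \<in> tile_edges E T \<Longrightarrow> \<pi> \<le> len e * inv_perimeter T"
    and e: "e \<in> E"
  shows "len e * char_real e \<le> 1 - 2 * \<mu> - 2 * \<pi>"
proof -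
  have "real (card (e \<inter> V)) * \<mu> \<le> (\<Sum>v\<in>e \<inter> V. len e / vertex_weight E len v)"
    using assms(1) e by (intro sum_bounded_below) (auto simp: incident_edges_def)
  moreover have "real (card (edge_tiles V E e)) * \<pi> \<le> (\<Sum>T\<in>edge_tiles V E e. len e * inv_perimeter T)"
    using assms(2) edge_tiles_iff[OF e] by (intro sum_bounded_below) blast
  moreover have "len e * char_real e = 1 - (\<Sum>v\<in>e \<inter> V. len e / vertex_weight E len v)
      - (\<Sum>T\<in>edge_tiles V E e. len e * inv_perimeter T)"
    using len_pos[OF e] by (auto simp: char_real_def right_diff_distrib sum_distrib_left)
  ultimately show ?thesis using card_ends[OF e] edge_two_tiles[OF e] by simp
qed

text \<open>Induction on the number of cut edges: absorbing a finite W without edges to the outside, or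
  splitting U into two parts without edges between them, leaves strictly fewer cut edges.\<close>

lemma star_estimate:
  fixes \<mu> \<pi> \<kappa> K c :: real
  assumes c: "0 < c" "\<And>e. e \<in> E \<Longrightarrow> c \<le> char_real e"
    and \<mu>: "0 \<le> \<mu>" "\<mu> \<le> 1 / 3"
      "\<And>v e. v \<in> V \<Longrightarrow> e \<in> incident_edges E v \<Longrightarrow> \<mu> \<le> len e / vertex_weight E len v"
      "\<And>v. 0 < \<mu> \<Longrightarrow> v \<in> V \<Longrightarrow> real (degree_in E v) \<le> 1 / \<mu>"
    and \<pi>: "0 \<le> \<pi>" "\<pi> \<le> 1 / 3"
      "\<And>T e. T \<in> tiles V E \<Longrightarrow> e \<in> tile_edges E T \<Longrightarrow> \<pi> \<le> len e * inv_perimeter T"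
      "\<And>T. 0 < \<pi> \<Longrightarrow> T \<in> tiles V E \<Longrightarrow> bounded T"
    and \<kappa>: "\<kappa> = (if \<mu> = 0 \<or> \<pi> = 0 then 0 else 1 / ((1 / \<mu> - 2) * (1 / \<pi>)))"
    and K: "K = 1 - \<mu> - 2 * \<pi> - \<kappa>" "0 \<le> K"
    and U: "finite U" "U \<subseteq> V"
  shows "c * mes len {e \<in> E. e \<inter> U \<noteq> {}} \<le> K * real (card (cut_edges U))"
  using U
proof (induction "card (cut_edges U)" arbitrary: U rule: less_induct)
  case less
  note U = less.prems
  let ?I = "inner_edges U" and ?C = "cut_edges U" and ?F = "full_tiles U"
  let ?W = "\<lambda>U. {e \<in> E. e \<inter> U \<noteq> {}}"
  have finC: "finite ?C" by (rule finite_inner_cut(2)[OF U])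
  have mes_mono: "mes len A \<le> mes len B" if "A \<subseteq> B" "finite B" "B \<subseteq> E" for A B
    unfolding mes_def using that len_pos by (intro sum_mono2) (auto simp: less_imp_le subset_iff)
  have cut_ne: "cut_edges A \<noteq> {}" if A: "finite A" "A \<subseteq> V" "A \<noteq> {}" for A
  proof -
    obtain e x y where e: "e \<in> E" "e \<inter> V = {x, y}" "x \<in> A" "y \<in> V - A" using leaving_edge[OF A] .
    then have "x \<in> e" "y \<in> e" by blast+
    then have "e \<in> cut_edges A" unfolding cut_edges_def using e by blast
    then show ?thesis by blast
  qed
  show ?case
  proof (cases "U = {}")
    case True
    then show ?thesis by (simp add: mes_def cut_edges_def)
  next
    case Une: False
    show ?thesis
    proof (cases "\<exists>W. finite W \<and> W \<noteq> {} \<and> W \<subseteq> V - U \<and> (\<forall>e\<in>E. e \<inter> W \<noteq> {} \<longrightarrow> e \<inter> V \<subseteq> U \<union> W)")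
      case True
      then obtain W where W: "finite W" "W \<noteq> {}" "W \<subseteq> V - U"
        "\<forall>e\<in>E. e \<inter> W \<noteq> {} \<longrightarrow> e \<inter> V \<subseteq> U \<union> W" by (elim exE conjE)
      have UW: "finite (U \<union> W)" "U \<union> W \<subseteq> V" using U W by auto
      have "W \<subseteq> V" using W(3) by blast
      then obtain e x y where e: "e \<in> E" "e \<inter> V = {x, y}" "x \<in> W" "y \<in> V - W"
        using leaving_edge[OF W(1) _ W(2)] by metis
      have xy: "x \<in> e" "y \<in> e" using e(2) by blast+
      have "e \<inter> W \<noteq> {}" using xy(1) e(3) by blast
      \<comment> \<open>By the choice of \<open>W\<close>, an edge leaving \<open>W\<close> ends in
        \<open>U\<close>. It is a cut edge of \<open>U\<close> that becomes inner in
        \<open>U \<union> W\<close>, so the number of cut edges drops.\<close>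
      then have "y \<in> U" using W(4) e(1,4) xy(2) by blast
      then have "e \<in> ?C" "e \<notin> cut_edges (U \<union> W)"
        unfolding cut_edges_def using e xy W(3) by auto
      moreover have "cut_edges (U \<union> W) \<subseteq> ?C"
      proof
        fix f assume "f \<in> cut_edges (U \<union> W)"
        then have f: "f \<in> E" "f \<inter> (U \<union> W) \<noteq> {}" "\<not> f \<inter> V \<subseteq> U \<union> W" by (auto simp: cut_edges_def)
        then have "f \<inter> W = {}" using W(4) by blast
        then show "f \<in> ?C" unfolding cut_edges_def using f by blast
      qed
      ultimately have less': "card (cut_edges (U \<union> W)) < card ?C"
        using finC by (intro psubset_card_mono) auto
      have "mes len (?W U) \<le> mes len (?W (U \<union> W))"
        using finite_incident[OF UW] by (intro mes_mono) auto
      then have "c * mes len (?W U) \<le> c * mes len (?W (U \<union> W))" using c(1) by simp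
      also have "\<dots> \<le> K * real (card (cut_edges (U \<union> W)))" by (rule less.hyps[OF less' UW])
      also have "\<dots> \<le> K * real (card ?C)" using less' K(2) by (intro mult_left_mono) auto
      finally show ?thesis .
    next
      case False
      then have fill: "\<exists>e\<in>E. e \<inter> W \<noteq> {} \<and> \<not> e \<inter> V \<subseteq> U \<union> W"
        if "finite W" "W \<noteq> {}" "W \<subseteq> V - U" for W
        using spec[OF False[unfolded not_ex], of W] that by auto
      show ?thesis
      proof (cases "\<exists>A. A \<subseteq> U \<and> A \<noteq> {} \<and> A \<noteq> U \<and> (\<forall>e\<in>?I. e \<inter> A = {} \<or> e \<inter> (U - A) = {})")
        case True
        then obtain A where A: "A \<subseteq> U" "A \<noteq> {}" "A \<noteq> U"
          "\<forall>e\<in>?I. e \<inter> A = {} \<or> e \<inter> (U - A) = {}" by (elim exE conjE)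
        define B where "B = U - A"
        have B: "B \<noteq> {}" "B \<subseteq> U" "A \<union> B = U" "A \<inter> B = {}" using A by (auto simp: B_def)
        have fA: "finite A" "A \<subseteq> V" and fB: "finite B" "B \<subseteq> V"
          using A(1) B(2) U finite_subset by blast+
        have sep: "e \<inter> A = {} \<or> e \<inter> B = {}" if e: "e \<in> E" for e
        proof (rule ccontr)
          assume "\<not> ?thesis"
          then obtain a b where ab: "a \<in> e" "a \<in> A" "b \<in> e" "b \<in> B" by blast
          then have "a \<in> V" "b \<in> V" using fA(2) fB(2) by blast+
          then obtain y where y: "e \<inter> V = {a, y}" using edge_other_end[OF e ab(1)] by metis
          have "b \<noteq> a" "b \<in> e \<inter> V" using ab B(4) \<open>b \<in> V\<close> by blast+
          then have "b = y" unfolding y by simp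
          then have "e \<in> ?I" using e y ab A(1) B(2) by (auto simp: inner_edges_def)
          then show False using A(4) ab by (auto simp: B_def)
        qed
        have cut: "?C = cut_edges A \<union> cut_edges B"
        proof (intro equalityI subsetI)
          fix e assume "e \<in> ?C"
          then have "e \<in> E" "e \<inter> U \<noteq> {}" "\<not> e \<inter> V \<subseteq> U" by (auto simp: cut_edges_def)
          then show "e \<in> cut_edges A \<union> cut_edges B" unfolding cut_edges_def using B(2,3) A(1) by blast
        next
          fix e assume "e \<in> cut_edges A \<union> cut_edges B"
          then have "e \<in> E" "e \<inter> A \<noteq> {} \<and> \<not> e \<inter> V \<subseteq> A \<or> e \<inter> B \<noteq> {} \<and> \<not> e \<inter> V \<subseteq> B"
            by (auto simp: cut_edges_def)
          then show "e \<in> ?C" unfolding cut_edges_def B(3)[symmetric] using sep[of e] by blast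
        qed
        have cdisj: "cut_edges A \<inter> cut_edges B = {}" using sep by (auto simp: cut_edges_def)
        have fcut: "finite (cut_edges A)" "finite (cut_edges B)" using finC cut by simp_all
        have card: "card ?C = card (cut_edges A) + card (cut_edges B)"
          unfolding cut using fcut cdisj by (rule card_Un_disjoint)
        \<comment> \<open>Each part has a cut edge of its own, so the other part has strictly fewer
          cut edges than \<open>U\<close>.\<close>
        have "card (cut_edges A) > 0" "card (cut_edges B) > 0"
          using cut_ne[OF fA A(2)] cut_ne[OF fB B(1)] fcut by (simp_all add: card_gt_0_iff)
        then have IH: "c * mes len (?W A) \<le> K * real (card (cut_edges A))"
          "c * mes len (?W B) \<le> K * real (card (cut_edges B))"
          using less.hyps[OF _ fA] less.hyps[OF _ fB] card by simp_all
        have "?W U = ?W A \<union> ?W B" using B(3) by blast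
        moreover have "?W A \<inter> ?W B = {}" using sep by blast
        ultimately have "mes len (?W U) = mes len (?W A) + mes len (?W B)"
          unfolding mes_def using finite_incident[OF fA] finite_incident[OF fB]
          by (simp add: sum.union_disjoint)
        then show ?thesis using IH card by (simp add: distrib_left)
      next
        case False
        then have conn: "\<exists>e\<in>?I. e \<inter> A \<noteq> {} \<and> e \<inter> (U - A) \<noteq> {}"
          if "A \<subseteq> U" "A \<noteq> {}" "A \<noteq> U" for A
          using spec[OF False[unfolded not_ex], of A] that by auto
        define b where "b = real (card ?C)"
        define r where "r = real (\<Sum>e\<in>?I. card (edge_tiles V E e - ?F))"
        have W: "?W U = ?I \<union> ?C" using inner_cut_edges(1)[OF U(2)] by simp
        have "c * mes len (?W U) \<le> (\<Sum>e\<in>?W U. len e * char_real e)"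
          unfolding mes_def sum_distrib_left
        proof (rule sum_mono)
          fix e assume "e \<in> ?W U"
          then have "e \<in> E" by blast
          then show "c * len e \<le> len e * char_real e"
            using c(2)[of e] len_pos[of e] by (simp add: mult.commute[of c] mult_left_mono)
        qed
        also have "\<dots> \<le> real (card ?I) + b - (real (card U) + \<mu> * b)
            - (real (card ?F) + \<pi> * (2 * b + r))"
          unfolding W b_def r_def using star_sum_estimate[OF U \<mu>(1,3) \<pi>(1,3)] by simp
        also have "\<dots> \<le> b - 1 - \<mu> * b - \<pi> * (2 * b + r)"
        proof -
          have "real (card ?I + 1) \<le> real (card U + card ?F)"
            using euler_inequality[OF U Une fill] of_nat_mono by blast
          then show ?thesis by simp
        qed
        also have "\<dots> \<le> K * b"
        proof -
          \<comment> \<open>Here \<open>1 / \<mu>\<close> and \<open>1 / \<pi>\<close> stand for M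
            and P. If both are finite, all tiles are bounded and the charging bound applies, its
            summand 3 being at most P. Multiplying by \<open>\<kappa>\<close> gives
            \<open>1 + \<pi> * r\<close>, which is what Euler's formula and the sides without full
            tiles provide.\<close>
          have "\<kappa> * b \<le> 1 + \<pi> * r"
          proof (cases "\<mu> = 0 \<or> \<pi> = 0")
            case True
            moreover have "0 \<le> r" unfolding r_def by (rule of_nat_0_le_iff)
            then have "0 \<le> \<pi> * r" using \<pi>(1) by (intro mult_nonneg_nonneg)
            ultimately show ?thesis by (simp add: \<kappa>)
          next
            case False
            then have pos: "0 < \<mu>" "0 < \<pi>" using \<mu>(1) \<pi>(1) by auto
            have M: "3 \<le> 1 / \<mu>" and P: "3 \<le> 1 / \<pi>" using pos \<mu>(2) \<pi>(2) by (simp_all add: field_simps)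
            have "b \<le> (1 / \<mu> - 2) * (r + 3)"
              unfolding b_def r_def
              using cut_edges_le_corners[OF \<pi>(4)[OF pos(2)] U Une conn M \<mu>(4)[OF pos(1)]] by simp
            also have "\<dots> \<le> (1 / \<mu> - 2) * (r + 1 / \<pi>)" using M P by (intro mult_left_mono) auto
            finally have "\<kappa> * b \<le> \<kappa> * ((1 / \<mu> - 2) * (r + 1 / \<pi>))"
              using M pos by (intro mult_left_mono) (auto simp: \<kappa>)
            also have "\<dots> = \<pi> * (r + 1 / \<pi>)" using M P False by (simp add: \<kappa>)
            also have "\<dots> = 1 + \<pi> * r" using pos by (simp add: algebra_simps)
            finally show ?thesis .
          qed
          then show ?thesis unfolding K(1) by (simp add: algebra_simps)
        qed
        finally show ?thesis unfolding b_def .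
      qed
    qed
  qed
qed

section \<open>From vertex sets to finite subgraphs\<close>

text \<open>The handshake identity writes the boundary degree as the number of ends in
  \<open>D\<close>, summed over the edges of \<open>E'\<close>. The end of a cut edge outside
  \<open>U\<close> is such an end, and an edge missing \<open>U\<close> has two of them; so
  \<open>star\<close> and \<open>edge\<close> together pay for all of \<open>E'\<close>.\<close>

lemma subgraph_estimate:
  fixes K c :: real
  assumes sub: "subgraph V' E' V E" "finite V'" "finite E'"
    and star: "\<And>U. finite U \<Longrightarrow> U \<subseteq> V \<Longrightarrow>
      c * mes len {e \<in> E. e \<inter> U \<noteq> {}} \<le> K * real (card (cut_edges U))"
    and edge: "\<And>e. e \<in> E \<Longrightarrow> c * len e \<le> 2 * K" and K: "0 \<le> K"
  shows "c * mes len E' \<le> K * real (boundary_degree E V' E')"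
proof -
  have V': "V' \<subseteq> V" and E': "E' \<subseteq> E" and ends: "\<And>e. e \<in> E' \<Longrightarrow> e \<inter> V \<subseteq> V'"
    using sub(1) by (auto simp: subgraph_def)
  define D where "D = boundary_vertices E V' E'"
  define U where "U = V' - D"
  have fin: "finite D" "finite U" using sub(2) by (auto simp: D_def U_def boundary_vertices_def)
  have UV: "U \<subseteq> V" using V' by (auto simp: U_def)
  let ?W = "{e \<in> E. e \<inter> U \<noteq> {}}"
  \<comment> \<open>A vertex of \<open>V'\<close> off the boundary has its full degree in the
    subgraph, so all its edges belong to \<open>E'\<close>.\<close>
  have WE': "?W \<subseteq> E'"
  proof
    fix e assume "e \<in> ?W"
    then obtain v where v: "e \<in> E" "v \<in> e" "v \<in> V'" "v \<notin> D" by (auto simp: U_def)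
    have fin_v: "finite (incident_edges E v)" using locally_finite v(3) V' by blast
    moreover have "incident_edges E' v \<subseteq> incident_edges E v" using E' by (auto simp: incident_edges_def)
    moreover have "card (incident_edges E v) \<le> card (incident_edges E' v)"
      using v by (auto simp: D_def boundary_vertices_def degree_in_def)
    ultimately have "incident_edges E' v = incident_edges E v" by (rule card_seteq)
    then show "e \<in> E'" using v by (auto simp: incident_edges_def)
  qed
  have cutW: "cut_edges U \<subseteq> ?W" by (auto simp: cut_edges_def)
  have finW: "finite ?W" using WE' sub(3) finite_subset by blast
  have two: "card (e \<inter> D) = 2" if e: "e \<in> E' - ?W" for e
  proof -
    have "e \<in> E" using e E' by blast
    moreover have "e \<inter> D = e \<inter> V" using e ends[of e] E' V' by (auto simp: U_def D_def boundary_vertices_def)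
    ultimately show ?thesis using card_ends by simp
  qed
  have one: "1 \<le> card (e \<inter> D)" if e: "e \<in> cut_edges U" for e
  proof -
    have "e \<in> E'" using e cutW WE' by blast
    then have "e \<inter> D \<noteq> {}" using e ends[of e] by (auto simp: cut_edges_def U_def)
    moreover have "finite (e \<inter> D)" using fin by simp
    ultimately show ?thesis by (simp add: Suc_leI card_gt_0_iff)
  qed
  have "card (cut_edges U) + 2 * card (E' - ?W) \<le> boundary_degree E V' E'"
  proof -
    have "boundary_degree E V' E' = (\<Sum>e\<in>E'. card (e \<inter> D))"
      unfolding boundary_degree_def D_def[symmetric] by (rule handshake[OF sub(3) fin(1)])
    also have "\<dots> = (\<Sum>e\<in>E' - ?W. card (e \<inter> D)) + (\<Sum>e\<in>?W. card (e \<inter> D))"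
      using WE' sub(3) by (rule sum.subset_diff)
    also have "(\<Sum>e\<in>E' - ?W. card (e \<inter> D)) = 2 * card (E' - ?W)" using two by simp
    finally have "boundary_degree E V' E' = 2 * card (E' - ?W) + (\<Sum>e\<in>?W. card (e \<inter> D))" .
    moreover have "card (cut_edges U) \<le> (\<Sum>e\<in>?W. card (e \<inter> D))"
    proof -
      have "card (cut_edges U) = (\<Sum>e\<in>cut_edges U. 1)" by simp
      also have "\<dots> \<le> (\<Sum>e\<in>cut_edges U. card (e \<inter> D))" using one by (intro sum_mono)
      also have "\<dots> \<le> (\<Sum>e\<in>?W. card (e \<inter> D))" using finW cutW by (intro sum_mono2) auto
      finally show ?thesis .
    qed
    ultimately show ?thesis by simp
  qed
  then have bd: "real (card (cut_edges U)) + 2 * real (card (E' - ?W)) \<le> real (boundary_degree E V' E')"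
    by linarith
  have "mes len E' = mes len (E' - ?W) + mes len ?W"
    unfolding mes_def using WE' sub(3) by (rule sum.subset_diff)
  then have "c * mes len E' = (\<Sum>e\<in>E' - ?W. c * len e) + c * mes len ?W"
    by (simp add: mes_def sum_distrib_left distrib_left)
  also have "\<dots> \<le> (\<Sum>e\<in>E' - ?W. 2 * K) + K * real (card (cut_edges U))"
    using star[OF fin(2) UV] edge E' by (intro add_mono sum_mono) auto
  also have "\<dots> = K * (real (card (cut_edges U)) + 2 * real (card (E' - ?W)))"
    by (simp add: algebra_simps)
  also have "\<dots> \<le> K * real (boundary_degree E V' E')" using bd K by (rule mult_left_mono)
  finally show ?thesis .
qed

end

theorem theorem3p3:
  fixes V :: "complex set" and E :: "complex set set" and len :: "complex set \<Rightarrow> real"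
  assumes "tessellating_metric_graph V E len"
    and "c_star V E len > 0"
  shows "isoperimetric_constant V E len \<ge> c_star V E len / K_const V E len \<and>
         c_star V E len / K_const V E len > 0"
proof -
  interpret tessellating_metric_graph V E len by fact
  obtain c where c: "c > 0" "c_star V E len = ereal c" "\<And>e. e \<in> E \<Longrightarrow> c \<le> char_real e"
    using c_star_real[OF assms(2)] by blast
  obtain \<mu> \<pi> \<kappa> :: real where \<mu>: "0 \<le> \<mu>" and \<pi>: "0 \<le> \<pi>"
    and \<mu>': "\<And>v e. v \<in> V \<Longrightarrow> e \<in> incident_edges E v \<Longrightarrow> \<mu> \<le> len e / vertex_weight E len v"
    and \<pi>': "\<And>T e. T \<in> tiles V E \<Longrightarrow> e \<in> tile_edges E T \<Longrightarrow> \<pi> \<le> len e * inv_perimeter T"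
    and bdd: "\<And>T. 0 < \<pi> \<Longrightarrow> T \<in> tiles V E \<Longrightarrow> bounded T"
    and deg: "\<And>v. 0 < \<mu> \<Longrightarrow> v \<in> V \<Longrightarrow> real (degree_in E v) \<le> 1 / \<mu>"
    and third: "\<mu> \<le> 1 / 3" "\<pi> \<le> 1 / 3"
    and \<kappa>: "\<kappa> = (if \<mu> = 0 \<or> \<pi> = 0 then 0 else 1 / ((1 / \<mu> - 2) * (1 / \<pi>)))"
    and K_const: "K_const V E len = ereal (1 - \<mu> - 2 * \<pi> - \<kappa>)"
  proof (rule reciprocal_constants, goal_cases)
    case (1 \<mu> \<pi> \<kappa>)
    show thesis by (rule that) (fact 1)+
  qed
  define K where "K = 1 - \<mu> - 2 * \<pi> - \<kappa>"
  \<comment> \<open>Since \<open>(M - 2) * P \<ge> 3 * (M - 2) \<ge> M\<close>. Thus K is at least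
    the bound \<open>1 - 2 * \<mu> - 2 * \<pi>\<close> for a single edge.\<close>
  have "\<kappa> \<le> \<mu>"
  proof (cases "\<mu> = 0 \<or> \<pi> = 0")
    case False
    then have pos: "0 < \<mu>" "0 < \<pi>" using \<mu> \<pi> by auto
    have M: "3 \<le> 1 / \<mu>" and P: "3 \<le> 1 / \<pi>" using pos third by (simp_all add: field_simps)
    have "1 / \<mu> \<le> (1 / \<mu> - 2) * 3" using M by simp
    also have "\<dots> \<le> (1 / \<mu> - 2) * (1 / \<pi>)" using M P by (intro mult_left_mono) auto
    finally have "1 / ((1 / \<mu> - 2) * (1 / \<pi>)) \<le> 1 / (1 / \<mu>)"
      using M pos by (intro divide_left_mono mult_pos_pos) auto
    then show ?thesis using False by (simp add: \<kappa>)
  qed (use \<mu> in \<open>auto simp: \<kappa>\<close>)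
  have edge: "c * len e \<le> K" if "e \<in> E" for e
  proof -
    have "c * len e \<le> len e * char_real e"
      using c(3)[OF that] len_pos[OF that] by (simp add: mult.commute[of c] mult_left_mono)
    also have "\<dots> \<le> 1 - 2 * \<mu> - 2 * \<pi>" using char_real_le[OF \<mu>' \<pi>' that] .
    also have "\<dots> \<le> K" using \<open>\<kappa> \<le> \<mu>\<close> by (simp add: K_def)
    finally show ?thesis .
  qed
  obtain e where "e \<in> E" by (rule obtain_edge)
  then have "0 < c * len e" using c(1) len_pos by simp
  \<comment> \<open>The formula for K alone does not give its sign (it is negative for
    \<open>\<mu> = \<pi> = 1 / 3\<close>); positivity comes from
    \<open>0 < c * len e \<le> K\<close> for any edge.\<close>
  then have K: "0 < K" using edge[OF \<open>e \<in> E\<close>] by linarith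
  have edge2: "c * len e \<le> 2 * K" if "e \<in> E" for e using edge[OF that] K by simp
  have star: "c * mes len {e \<in> E. e \<inter> U \<noteq> {}} \<le> K * real (card (cut_edges U))"
    if "finite U" "U \<subseteq> V" for U
    using star_estimate[OF c(1,3) \<mu> third(1) \<mu>' deg \<pi> third(2) \<pi>' bdd \<kappa> K_def _ that] K by simp
  have quot: "c_star V E len / K_const V E len = ereal (c / K)"
    unfolding c(2) K_const K_def[symmetric] using K by simp
  have "ereal (c / K) \<le> isoperimetric_constant V E len"
    unfolding isoperimetric_constant_def
  proof (rule INF_greatest, clarify)
    fix V' E'
    assume sub: "subgraph V' E' V E" "finite V'" "finite E'" "E' \<noteq> {}"
    have "c * mes len E' \<le> K * real (boundary_degree E V' E')"
      by (rule subgraph_estimate[OF sub(1-3) star edge2]) (use K in auto)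
    moreover have "0 < mes len E'"
      unfolding mes_def using sub by (intro sum_len_pos) (auto simp: subgraph_def)
    ultimately show "ereal (c / K) \<le> ereal (real (boundary_degree E V' E') / mes len E')"
      using K by (simp add: field_simps)
  qed
  then show ?thesis unfolding quot using c(1) K by simp
qed

end
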